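(* Let $X=\{X_t\colon t\ge 0\}$ be a real-valued Lévy process, let $r>0$ be a discount rate, and let $g\colon\mathbb{R}\to[0,\infty)$ be a continuous reward function. Assume that there exist two points $-x_1<0<x_2$ and two continuous monotone functions $Q_1,Q_2\colon\mathbb{R}\to\mathbb{R}$ such that $Q_1$ is non-increasing with $Q_1(x)=0$ for all $x\ge -x_1$, $Q_2$ is non-decreasing with $Q_2(x)=0$ for all $x\le x_2$, and $$g(x)=\mathbf{E}_x Q_1(I)+\mathbf{E}_x Q_2(M)\quad\text{for all } x\notin(-x_1,x_2).$$ Define $$V(x)=\mathbf{E}_x\big(Q_1(I)+Q_2(M)\big)\quad\text{for all } x\in\mathbb{R}.$$ If $V(x)\ge g(x)$ for all $x\in[-x_1,x_2]$, then the optimal stopping problem with reward $g$ and discount rate $r$ has value function $V$, and $$\tau^*=\inf\{t\ge 0\colon X_t\notin(-x_1,x_2)\}$$ is an optimal stopping time; that is, for all $x\in\mathbb{R}$, $$V(x)=\sup_{\tau\in\mathcal{M}}\mathbf{E}_x\big(e^{-r\tau}g(X_\tau)\big)=\mathbf{E}_x\big(e^{-r\tau^*}g(X_{\tau^*})\big).$$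
   Context: The Lévy process $X$ is defined on a stochastic basis $(\Omega,\mathcal{F},(\mathcal{F}_t)_{t\ge0},\mathbf{P}_x)$ (a filtered probability space satisfying the usual conditions, with $X$ a Lévy process relative to the filtration); under $\mathbf{P}_x$ the process starts from $X_0=x$, and $\mathbf{E}_x$ denotes the corresponding expectation. The class of stopping times $\mathcal{M}$ is the set of all $\tau\colon\Omega\to[0,\infty]$ with $\{\tau\le t\}\in\mathcal{F}_t$ for all $t\ge0$ (the value $\tau=\infty$ is allowed). The payoff on $\{\tau=\infty\}$ is zero: $e^{-r\tau}g(X_\tau)$ means $e^{-r\tau}g(X_\tau)\mathbf{1}_{\{\tau<\infty\}}$. The random variables $$M=\sup\{X_t\colon 0\le t\le e_r\},\qquad I=\inf\{X_t\colon 0\le t\le e_r\}$$ are the supremum and infimum of $X$ up to $e_r$, where $e_r$ is an exponential random variable with parameter $r$ (mean $1/r$), independent of $X$. *)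

theory Defs
  imports "HOL-Probability.Probability"
begin

definition cadlag :: "(real \<Rightarrow> real) \<Rightarrow> bool" where
  "cadlag f \<longleftrightarrow> (\<forall>t\<ge>0. continuous (at_right t) f) \<and> (\<forall>t>0. \<exists>l. (f \<longlongrightarrow> l) (at_left t))"

text \<open>
  Time runs through \<open>[0,\<infinity>]\<close>, represented by \<^typ>\<open>ennreal\<close>, so that \<^const>\<open>stopping_time\<close> covers
  stopping times that take the value \<open>\<infinity>\<close>; its condition at \<open>t = \<infinity>\<close> is vacuous.
  The measurable space \<open>F \<top>\<close> is the ambient \<open>(\<Omega>,\<F>)\<close> on which all the measures \<open>P x\<close> live.

  One filtration serves all starting points. Completeness therefore refers to the sets that are
  negligible under every \<open>P x\<close>, the usual form for a family of measures: adjoining to \<open>F 0\<close> the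
  null sets of each single \<open>P x\<close> would put every subset of \<open>\<Omega>\<close> into \<open>F 0\<close>, because the events
  \<open>X\<^sub>0 = x\<close> are disjoint and \<open>P x\<close> is concentrated on the one belonging to \<open>x\<close>.
\<close>

locale stochastic_basis = filtration \<Omega> F
  for \<Omega> :: "'a set" and F :: "ennreal \<Rightarrow> 'a measure" +
  fixes P :: "real \<Rightarrow> 'a measure"
  assumes prob_space_P: "\<And>x. prob_space (P x)"
    and sets_P: "\<And>x. sets (P x) = sets (F \<top>)"
    and right_continuous: "\<And>t. t < \<top> \<Longrightarrow> sets (F t) = (\<Inter>u\<in>{t<..}. sets (F u))"
    and complete: "\<And>N. (\<And>x. \<exists>B\<in>null_sets (P x). N \<subseteq> B) \<Longrightarrow> N \<in> sets (F 0)"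

text \<open>
  Only the values \<open>X t\<close> with \<open>t \<ge> 0\<close> matter. The law of an increment is required to be the same
  under all \<open>P x\<close>, that is, \<open>P x\<close> is the law of the same Levy process started from \<open>x\<close>.
  Stochastic continuity follows from the other conditions.
\<close>

locale levy_process = stochastic_basis \<Omega> F P
  for \<Omega> :: "'a set" and F :: "ennreal \<Rightarrow> 'a measure" and P :: "real \<Rightarrow> 'a measure" +
  fixes X :: "real \<Rightarrow> 'a \<Rightarrow> real"
  assumes adapted: "\<And>t. 0 \<le> t \<Longrightarrow> X t \<in> borel_measurable (F (ennreal t))"
    and starts_at: "\<And>x. AE \<omega> in P x. X 0 \<omega> = x"
    and cadlag_paths: "\<And>x. AE \<omega> in P x. cadlag (\<lambda>t. X t \<omega>)"
    and independent_increments: "\<And>x s t. 0 \<le> s \<Longrightarrow> s < t \<Longrightarrow>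
      prob_space.indep_set (P x) (sets (F (ennreal s)))
        (sets (vimage_algebra \<Omega> (\<lambda>\<omega>. X t \<omega> - X s \<omega>) borel))"
    and stationary_increments: "\<And>x s h. 0 \<le> s \<Longrightarrow> 0 \<le> h \<Longrightarrow>
      distr (P x) borel (\<lambda>\<omega>. X (s + h) \<omega> - X s \<omega>) = distr (P 0) borel (\<lambda>\<omega>. X h \<omega> - X 0 \<omega>)"

definition independent_exponential_time ::
  "(real \<Rightarrow> 'a measure) \<Rightarrow> (real \<Rightarrow> 'a \<Rightarrow> real) \<Rightarrow> real \<Rightarrow> ('a \<Rightarrow> real) \<Rightarrow> bool" where
  "independent_exponential_time P X r e \<longleftrightarrow> (\<forall>x.
     distributed (P x) lborel e (exponential_density r) \<and>
     prob_space.indep_set (P x)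
       (sets (vimage_algebra (space (P x)) (\<lambda>\<omega>. \<lambda>t\<in>{0..}. X t \<omega>) (Pi\<^sub>M {0..} (\<lambda>_. borel))))
       (sets (vimage_algebra (space (P x)) e borel)))"

definition running_sup :: "(real \<Rightarrow> 'a \<Rightarrow> real) \<Rightarrow> ('a \<Rightarrow> real) \<Rightarrow> 'a \<Rightarrow> real" where
  "running_sup X e \<omega> = (SUP t\<in>{0..e \<omega>}. X t \<omega>)"

definition running_inf :: "(real \<Rightarrow> 'a \<Rightarrow> real) \<Rightarrow> ('a \<Rightarrow> real) \<Rightarrow> 'a \<Rightarrow> real" where
  "running_inf X e \<omega> = (INF t\<in>{0..e \<omega>}. X t \<omega>)"

definition discounted_reward ::
  "real \<Rightarrow> (real \<Rightarrow> real) \<Rightarrow> (real \<Rightarrow> 'a \<Rightarrow> real) \<Rightarrow> ('a \<Rightarrow> ennreal) \<Rightarrow> 'a \<Rightarrow> real" where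
  "discounted_reward r g X \<tau> \<omega> =
     (if \<tau> \<omega> < \<top> then exp (- r * enn2real (\<tau> \<omega>)) * g (X (enn2real (\<tau> \<omega>)) \<omega>) else 0)"

definition exit_time :: "(real \<Rightarrow> 'a \<Rightarrow> real) \<Rightarrow> real set \<Rightarrow> 'a \<Rightarrow> ennreal" where
  "exit_time X A \<omega> = Inf {ennreal t | t. 0 \<le> t \<and> X t \<omega> \<notin> A}"

text \<open>
  For nonnegative \<open>Y\<close> the expectation always exists in \<open>[0,\<infinity>]\<close>, and \<^const>\<open>ennreal\<close> truncates
  nothing.
\<close>

definition expectation_nonneg :: "'a measure \<Rightarrow> ('a \<Rightarrow> real) \<Rightarrow> ennreal" where
  "expectation_nonneg M Y = (\<integral>\<^sup>+\<omega>. ennreal (Y \<omega>) \<partial>M)"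

end

theory Submission
  imports Defs
begin

text \<open>
  For a monotone \<open>Q\<close> vanishing up to a level \<open>b\<close>, Fubini's theorem writes \<open>E\<^sub>x Q(M)\<close> as
  \<open>E\<^sub>x \<integral> r exp(-r s) sup {Q (X\<^sub>t) | t \<le> s} ds\<close>. If the integral and the supremum are restricted to times
  after a stopping time \<open>\<tau>\<close>, the strong Markov property turns the result into
  \<open>E\<^sub>x exp(-r \<tau>) v(X\<^sub>\<tau>)\<close> with \<open>v(y) = E\<^sub>y Q(M)\<close>. The restriction can only decrease the value, so
  \<open>v\<close> is excessive, and it changes nothing if \<open>X \<le> b\<close> before \<open>\<tau>\<close>. Applying this to \<open>(X, Q\<^sub>2)\<close> and, for
  the infimum, to \<open>(-X, Q\<^sub>1(-x))\<close> shows that \<open>V\<close> dominates the reward of every stopping time and is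
  attained at the exit time of the interval, where \<open>V = g\<close>.

  As the filtration is completed only by the sets negligible under every \<open>P x\<close>, the exit time is
  shown to be a stopping time by quasi-left-continuity: it is almost surely the limit of the exit
  times from smaller closed intervals.
\<close>

section \<open>Right-continuous paths\<close>

text \<open>The time \<open>e\<close> is independent of the path but is not assumed to be
  independent of the filtration, so it cannot be restarted at a stopping time. It is integrated out
  first, and the strong Markov property is needed only for suprema over \<open>[0,u]\<close> with
  \<open>u\<close> fixed. The exponential law returns in one identity: \<open>exp (- r * t)\<close>
  times the density at \<open>s\<close> is the density at \<open>t + s\<close>, which turns
  discounting into a shift of the integration variable.

  All expectations are taken in [0,\<infinity>]. Passing from stopping times with countably many
  values to general ones uses dominated convergence and continuity in the starting point, and
  neither need hold for the supremum of an unbounded function. Maxima over finite dyadic grids,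
  truncated at height \<open>n\<close>, have both properties, and they increase to the supremum
  because the paths are right-continuous. On a finite grid the Markov property is a recursion over
  single increments, so no law on a path space has to be constructed.\<close>

lemma right_limit_sequentially:
  fixes f :: "real \<Rightarrow> 'b::topological_space"
  assumes f: "(f \<longlongrightarrow> f t) (at_right t)" and s: "s \<longlonglongrightarrow> t" and le: "\<And>n. t \<le> s n"
  shows "(\<lambda>n. f (s n)) \<longlonglongrightarrow> f t"
proof (rule topological_tendstoI)
  fix S assume S: "open S" "f t \<in> S"
  from topological_tendstoD[OF f S] obtain b where b: "t < b" "\<And>y. t < y \<Longrightarrow> y < b \<Longrightarrow> f y \<in> S"
    by (auto simp: eventually_at_right_field)
  from order_tendstoD(2)[OF s b(1)] show "eventually (\<lambda>n. f (s n) \<in> S) sequentially"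
  proof eventually_elim
    case (elim n)
    \<comment> \<open>The sequence may hit \<open>t\<close> itself, where \<open>at_right t\<close>
      says nothing.\<close>
    then show ?case using b(2)[of "s n"] le[of n] S(2) by (cases "s n = t") auto
  qed
qed

lemma tendsto_at_right_shift:
  fixes f :: "real \<Rightarrow> 'b::topological_space"
  assumes "(f \<longlongrightarrow> l) (at_right (t + c))"
  shows "((\<lambda>s. f (s + c)) \<longlongrightarrow> l) (at_right t)"
  using assms unfolding filterlim_at_right_to_0[of _ _ t] filterlim_at_right_to_0[of _ _ "t + c"]
  by (simp add: ac_simps)

text \<open>The first multiple of \<open>1 / (n + 1)\<close> strictly above \<open>t\<close>. It
  takes countably many values and approaches \<open>t\<close> from the right. Strictness makes the
  event that a rounded stopping time equals a given grid point known at that point.\<close>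

definition upper_grid :: "nat \<Rightarrow> real \<Rightarrow> real" where
  "upper_grid n t = real (Suc (nat \<lfloor>t * real (Suc n)\<rfloor>)) / real (Suc n)"

lemma upper_grid_bounds:
  assumes "0 \<le> t"
  shows "t < upper_grid n t" "upper_grid n t \<le> t + 1 / real (Suc n)"
proof -
  have "0 \<le> t * real (Suc n)" using assms by simp
  then have *: "real (nat \<lfloor>t * real (Suc n)\<rfloor>) = of_int \<lfloor>t * real (Suc n)\<rfloor>" by simp
  have "t * real (Suc n) < real (Suc (nat \<lfloor>t * real (Suc n)\<rfloor>))"
    using * by linarith
  then show "t < upper_grid n t"
    by (simp add: upper_grid_def pos_less_divide_eq)
  have "real (Suc (nat \<lfloor>t * real (Suc n)\<rfloor>)) \<le> t * real (Suc n) + 1"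
    using * by linarith
  then have "upper_grid n t \<le> (t * real (Suc n) + 1) / real (Suc n)"
    unfolding upper_grid_def by (rule divide_right_mono) simp
  then show "upper_grid n t \<le> t + 1 / real (Suc n)"
    by (simp add: add_divide_distrib)
qed

lemma upper_grid_tendsto:
  assumes "0 \<le> t"
  shows "(\<lambda>n. upper_grid n t) \<longlonglongrightarrow> t"
proof (rule tendsto_sandwich[OF _ _ tendsto_const])
  show "(\<lambda>n. t + 1 / real (Suc n)) \<longlonglongrightarrow> t"
    using tendsto_add[OF tendsto_const LIMSEQ_Suc[OF lim_1_over_n]] by auto
  show "\<forall>\<^sub>F n in sequentially. t \<le> upper_grid n t"
    using upper_grid_bounds(1)[OF assms] by (auto intro!: always_eventually less_imp_le)
  show "\<forall>\<^sub>F n in sequentially. upper_grid n t \<le> t + 1 / real (Suc n)"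
    using upper_grid_bounds(2)[OF assms] by (auto intro!: always_eventually)
qed

text \<open>Rounding \<open>T\<close> up leaves countably many times, and right-continuity gives the
  pointwise limit. The map \<open>W\<close> allows the path to be read off a coordinate of a product
  space.\<close>

lemma measurable_right_continuous_compose:
  fixes Y :: "real \<Rightarrow> 'a \<Rightarrow> 'b::metric_space"
  assumes Y: "\<And>t. 0 \<le> t \<Longrightarrow> Y t \<in> borel_measurable N"
    and rc: "\<And>\<omega> t. \<omega> \<in> space N \<Longrightarrow> 0 \<le> t \<Longrightarrow> ((\<lambda>s. Y s \<omega>) \<longlongrightarrow> Y t \<omega>) (at_right t)"
    and T [measurable]: "T \<in> borel_measurable M" and T0: "\<And>z. z \<in> space M \<Longrightarrow> 0 \<le> T z"
    and W: "W \<in> measurable M N"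
  shows "(\<lambda>z. Y (T z) (W z)) \<in> borel_measurable M"
proof (rule borel_measurable_LIMSEQ_metric)
  fix z assume "z \<in> space M"
  with T0 measurable_space[OF W]
  show "(\<lambda>n. Y (upper_grid n (T z)) (W z)) \<longlonglongrightarrow> Y (T z) (W z)"
    by (intro right_limit_sequentially[where f="\<lambda>s. Y s (W z)"] rc upper_grid_tendsto
        less_imp_le[OF upper_grid_bounds(1)]) auto
next
  fix n
  have "(\<lambda>z. Y (real (Suc k) / real (Suc n)) (W z)) \<in> borel_measurable M" for k
    by (rule measurable_compose[OF W Y]) simp
  then show "(\<lambda>z. Y (upper_grid n (T z)) (W z)) \<in> borel_measurable M"
    unfolding upper_grid_def
    by (rule measurable_compose_countable[where f="\<lambda>k z. Y (real (Suc k) / real (Suc n)) (W z)"]) measurable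
qed

text \<open>One-sided limits bound the path near each point, and compactness of the interval does
  the rest.\<close>

lemma cadlag_bdd_above:
  fixes f :: "real \<Rightarrow> real"
  assumes "cadlag f" "0 \<le> s"
  shows "bdd_above (f ` {0..s})"
proof -
  \<comment> \<open>The subdivision argument also tests intervals around 0 that reach into negative
    times, where nothing is known; the intersection discards these times.\<close>
  have "bdd_above (f ` ({0..s} \<inter> {0..}))"
    using \<open>0 \<le> s\<close>
  proof (rule Bolzano[where P="\<lambda>a b. bdd_above (f ` ({a..b} \<inter> {0..}))"], goal_cases)
    case trans: (1 a b c)
    have "{a..c} \<inter> {0..} = ({a..b} \<inter> {0..}) \<union> ({b..c} \<inter> {0..})"
      using trans by auto
    with trans show ?case by (simp only: image_Un bdd_above_Un)
  next
    case local: (2 x)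
    have "(f \<longlongrightarrow> f x) (at_right x)"
      using assms(1) local by (auto simp: cadlag_def continuous_within)
    from order_tendstoD(2)[OF this, of "f x + 1"] obtain b where
      b: "x < b" "\<And>y. x < y \<Longrightarrow> y < b \<Longrightarrow> f y < f x + 1"
      by (auto simp: eventually_at_right_field)
    have "\<exists>a<x. \<exists>c. \<forall>y. a < y \<longrightarrow> 0 \<le> y \<longrightarrow> y < x \<longrightarrow> f y \<le> c"
    proof (cases "0 < x")
      case True
      with assms(1) obtain l where "(f \<longlongrightarrow> l) (at_left x)" by (auto simp: cadlag_def)
      from order_tendstoD(2)[OF this, of "l + 1"] show ?thesis
        by (auto simp: eventually_at_left_field intro: less_imp_le)
    next
      case False
      then show ?thesis by (intro exI[of _ "x - 1"]) auto
    qed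
    then obtain a c where a: "a < x" "\<And>y. a < y \<Longrightarrow> 0 \<le> y \<Longrightarrow> y < x \<Longrightarrow> f y \<le> c" by blast
    show ?case
    proof (intro exI[of _ "min (b - x) (x - a)"] conjI allI impI)
      fix l u assume lu: "l \<le> x \<and> x \<le> u \<and> u - l < min (b - x) (x - a)"
      have "f y \<le> max c (f x + 1)" if "y \<in> {l..u} \<inter> {0..}" for y
        using a(2)[of y] b(2)[of y] that lu by (cases y x rule: linorder_cases) (auto simp: le_max_iff_disj)
      then show "bdd_above (f ` ({l..u} \<inter> {0..}))" by (rule bdd_aboveI2)
    qed (use a b in auto)
  qed
  moreover have "{0..s} \<inter> {0..} = {0..s}" by auto
  ultimately show ?thesis by simp
qed

text \<open>Truncating at height \<open>n\<close> while refining the grid makes every approximation bounded.\<close>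
definition grid_sup :: "(real \<Rightarrow> ennreal) \<Rightarrow> real \<Rightarrow> nat \<Rightarrow> ennreal" where
  "grid_sup f u n = (SUP k\<in>{..2 ^ n}. min (f (real k * (u / 2 ^ n))) (of_nat n))"

lemma incseq_grid_sup: "incseq (grid_sup f u)"
proof (rule incseq_SucI)
  fix n
  show "grid_sup f u n \<le> grid_sup f u (Suc n)"
    unfolding grid_sup_def
  proof (rule SUP_mono)
    fix k :: nat assume "k \<in> {..2 ^ n}"
    \<comment> \<open>Node \<open>k\<close> of one dyadic grid is node \<open>2 * k\<close> of the
      next.\<close>
    then show "\<exists>m\<in>{..2 ^ Suc n}. min (f (real k * (u / 2 ^ n))) (of_nat n)
        \<le> min (f (real m * (u / 2 ^ Suc n))) (of_nat (Suc n))"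
      by (intro bexI[of _ "2 * k"]) (auto simp: min.coboundedI2 min_le_iff_disj intro: order_trans[of _ "of_nat n"])
  qed
qed

text \<open>Every time is a limit from the right of dyadic nodes, so right-continuity is enough for
  the countable grid to see the whole supremum.\<close>

lemma SUP_grid_sup:
  fixes f :: "real \<Rightarrow> ennreal"
  assumes f: "\<And>t. 0 \<le> t \<Longrightarrow> (f \<longlongrightarrow> f t) (at_right t)" and u: "0 \<le> u"
  shows "(SUP n. grid_sup f u n) = (SUP t\<in>{0..u}. f t)"
proof (rule antisym)
  show "(SUP n. grid_sup f u n) \<le> (SUP t\<in>{0..u}. f t)"
    unfolding grid_sup_def
  proof (intro SUP_least)
    fix n k :: nat assume "k \<in> {..2 ^ n}"
    then have "real k \<le> 2 ^ n"
      using of_nat_le_iff[of k "2 ^ n", where ?'a=real] by (simp del: of_nat_le_iff)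
    then have "real k * (u / 2 ^ n) \<le> 2 ^ n * (u / 2 ^ n)"
      using u by (intro mult_right_mono) auto
    then have "real k * (u / 2 ^ n) \<in> {0..u}"
      using u by auto
    then show "min (f (real k * (u / 2 ^ n))) (of_nat n) \<le> (SUP t\<in>{0..u}. f t)"
      by (intro min.coboundedI1 SUP_upper)
  qed
  show "(SUP t\<in>{0..u}. f t) \<le> (SUP n. grid_sup f u n)"
  proof (rule SUP_least)
    fix t assume t: "t \<in> {0..u}"
    \<comment> \<open>Rounding up keeps \<open>s n\<close> at or to the right of \<open>t\<close>,
      and \<open>t \<le> u\<close> keeps it inside the grid. For \<open>u = 0\<close> the quotient
      is 0 and all nodes coincide with \<open>t = 0\<close>.\<close>
    define k where "k n = nat \<lceil>t / u * 2 ^ n\<rceil>" for n :: nat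
    define s where "s n = real (k n) * (u / 2 ^ n)" for n
    have k: "k n \<le> 2 ^ n" for n
    proof -
      have "t / u * 2 ^ n \<le> 2 ^ n" using t by (auto simp: divide_le_eq)
      then have "\<lceil>t / u * 2 ^ n\<rceil> \<le> 2 ^ n"
        by (simp add: ceiling_le_iff)
      then show ?thesis unfolding k_def by (simp add: nat_le_iff)
    qed
    have s: "t \<le> s n \<and> s n \<le> t + u * (1/2) ^ n" for n
    proof (cases "u = 0")
      case True
      with t show ?thesis by (simp add: s_def)
    next
      case False
      with u have u: "0 < u" by simp
      have "0 \<le> t / u * 2 ^ n" using t by auto
      then have "real (k n) = of_int \<lceil>t / u * 2 ^ n\<rceil>" unfolding k_def by simp
      then have "t / u * 2 ^ n \<le> real (k n)" "real (k n) \<le> t / u * 2 ^ n + 1" by linarith+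
      then have "t / u * 2 ^ n * (u / 2 ^ n) \<le> s n" "s n \<le> (t / u * 2 ^ n + 1) * (u / 2 ^ n)"
        unfolding s_def using u by (intro mult_right_mono; simp)+
      moreover have "t / u * 2 ^ n * (u / 2 ^ n) = t" using u by simp
      moreover have "u / 2 ^ n = u * (1/2) ^ n" by (simp add: power_divide)
      ultimately show ?thesis by (simp only: distrib_right mult_1)
    qed
    have "(\<lambda>n. t + u * (1/2) ^ n) \<longlonglongrightarrow> t + u * 0"
      by (intro tendsto_intros LIMSEQ_realpow_zero) auto
    then have "s \<longlonglongrightarrow> t"
      using s by (intro tendsto_sandwich[of "\<lambda>_. t" s _ "\<lambda>n. t + u * (1/2) ^ n"]) auto
    then have "(\<lambda>n. f (s n)) \<longlonglongrightarrow> f t"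
      using s t by (intro right_limit_sequentially[OF f]) simp_all
    moreover have "(\<lambda>n. of_nat n :: ennreal) \<longlonglongrightarrow> top"
      by (rule of_nat_tendsto_top_ennreal)
    ultimately have "(\<lambda>n. min (f (s n)) (of_nat n)) \<longlonglongrightarrow> min (f t) top"
      by (rule tendsto_min)
    then have "(\<lambda>n. min (f (s n)) (of_nat n)) \<longlonglongrightarrow> f t" by (simp add: min_def)
    moreover have "min (f (s n)) (of_nat n) \<le> (SUP n. grid_sup f u n)" for n
    proof -
      have "min (f (s n)) (of_nat n) \<le> grid_sup f u n"
        unfolding grid_sup_def s_def using k[of n] by (intro SUP_upper2[of "k n"]) auto
      also have "\<dots> \<le> (SUP n. grid_sup f u n)" by (rule SUP_upper) simp
      finally show ?thesis .
    qed
    ultimately show "f t \<le> (SUP n. grid_sup f u n)"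
      by (rule LIMSEQ_le_const2[OF _ exI, OF _ allI, OF _ impI])
  qed
qed

text \<open>The node at time 0 is known before any increment is observed. It becomes the initial
  record of the recursion \<open>grid_value\<close>, and the other nodes are reached by one
  increment each.\<close>

lemma grid_sup_eq:
  "grid_sup f u n = sup (min (f 0) (of_nat n)) (SUP k\<in>{..<2 ^ n}. min (f (real (Suc k) * (u / 2 ^ n))) (of_nat n))"
proof -
  have "{..2 ^ n} = insert (0::nat) (Suc ` {..<2 ^ n})"
    by (simp flip: lessThan_Suc_atMost add: lessThan_Suc_eq_insert_0)
  then show ?thesis unfolding grid_sup_def by (simp add: image_comp o_def)
qed

lemma grid_sup_le: "grid_sup f u n \<le> of_nat n"
  unfolding grid_sup_def by (intro SUP_least) simp

text \<open>Limits commute with finite maxima, but not with suprema in general; this is what makes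
  finite grids useful.\<close>

lemma tendsto_SUP_finite:
  fixes f :: "'i \<Rightarrow> 'a \<Rightarrow> ennreal"
  assumes "finite I" "\<And>i. i \<in> I \<Longrightarrow> ((\<lambda>x. f i x) \<longlongrightarrow> l i) G"
  shows "((\<lambda>x. SUP i\<in>I. f i x) \<longlongrightarrow> (SUP i\<in>I. l i)) G"
  using assms
proof (induction I)
  case (insert i I)
  have "((\<lambda>x. max (f i x) (SUP i\<in>I. f i x)) \<longlongrightarrow> max (l i) (SUP i\<in>I. l i)) G"
    using insert by (intro tendsto_max) auto
  then show ?case by (simp add: sup_max)
qed simp

section \<open>Processes at stopping times\<close>

text \<open>The joint law is the product of the marginal laws. Independence is assumed between
  families of sets, so that \<open>X\<close> may be any variable measurable with respect to the
  past, or the sample point itself seen through the sigma-algebra of the path.\<close>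

lemma (in prob_space) nn_integral_indep:
  assumes indep: "indep_set A B"
    and X: "X \<in> measurable M S" "\<And>E. E \<in> sets S \<Longrightarrow> X -` E \<inter> space M \<in> A"
    and Y: "Y \<in> measurable M T" "\<And>E. E \<in> sets T \<Longrightarrow> Y -` E \<inter> space M \<in> B"
    and f: "f \<in> borel_measurable (S \<Otimes>\<^sub>M T)"
  shows "(\<integral>\<^sup>+\<omega>. f (X \<omega>, Y \<omega>) \<partial>M) = (\<integral>\<^sup>+\<omega>. \<integral>\<^sup>+\<omega>'. f (X \<omega>, Y \<omega>') \<partial>M \<partial>M)"
proof -
  note [measurable] = f X(1) Y(1)
  have prod: "distr M S X \<Otimes>\<^sub>M distr M T Y = distr M (S \<Otimes>\<^sub>M T) (\<lambda>x. (X x, Y x))"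
  proof (rule pair_measure_eqI)
    show "sigma_finite_measure (distr M S X)" "sigma_finite_measure (distr M T Y)"
      by (auto intro!: prob_space_imp_sigma_finite prob_space_distr)
    fix D E assume "D \<in> sets (distr M S X)" "E \<in> sets (distr M T Y)"
    then have [measurable]: "D \<in> sets S" "E \<in> sets T" by auto
    have "emeasure (distr M (S \<Otimes>\<^sub>M T) (\<lambda>x. (X x, Y x))) (D \<times> E)
        = emeasure M ((X -` D \<inter> space M) \<inter> (Y -` E \<inter> space M))"
      by (subst emeasure_distr) (auto intro!: arg_cong[where f="emeasure M"])
    also have "\<dots> = emeasure M (X -` D \<inter> space M) * emeasure M (Y -` E \<inter> space M)"
      using indep_setD[OF indep X(2) Y(2), of D E]
      by (simp add: emeasure_eq_measure ennreal_mult)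
    finally show "emeasure (distr M S X) D * emeasure (distr M T Y) E
        = emeasure (distr M (S \<Otimes>\<^sub>M T) (\<lambda>x. (X x, Y x))) (D \<times> E)"
      by (simp add: emeasure_distr)
  qed simp
  interpret Y: prob_space "distr M T Y" by (rule prob_space_distr) measurable
  have "(\<integral>\<^sup>+\<omega>. f (X \<omega>, Y \<omega>) \<partial>M) = integral\<^sup>N (distr M S X \<Otimes>\<^sub>M distr M T Y) f"
    unfolding prod by (subst nn_integral_distr) auto
  also have "\<dots> = (\<integral>\<^sup>+x. \<integral>\<^sup>+y. f (x, y) \<partial>distr M T Y \<partial>distr M S X)"
    by (rule Y.nn_integral_fst[symmetric]) measurable
  also have "\<dots> = (\<integral>\<^sup>+\<omega>. \<integral>\<^sup>+y. f (X \<omega>, y) \<partial>distr M T Y \<partial>M)"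
    by (rule nn_integral_distr) measurable
  also have "\<dots> = (\<integral>\<^sup>+\<omega>. \<integral>\<^sup>+\<omega>'. f (X \<omega>, Y \<omega>') \<partial>M \<partial>M)"
  proof (rule nn_integral_cong)
    fix \<omega> assume "\<omega> \<in> space M"
    then have "(\<lambda>y. f (X \<omega>, y)) \<in> borel_measurable T"
      using measurable_space[OF \<open>X \<in> measurable M S\<close>] by measurable
    then show "(\<integral>\<^sup>+y. f (X \<omega>, y) \<partial>distr M T Y) = (\<integral>\<^sup>+\<omega>'. f (X \<omega>, Y \<omega>') \<partial>M)"
      by (intro nn_integral_distr) auto
  qed
  finally show ?thesis .
qed

section \<open>Rounding stopping times up to a grid\<close>

context stochastic_basis
begin

lemma space_P: "space (P x) = \<Omega>"
  using sets_eq_imp_space_eq[OF sets_P] space_F by simp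

lemma measurable_F_P: "f \<in> measurable (F t) N \<Longrightarrow> f \<in> measurable (P x) N"
  using sets_F_mono[of t \<top>]
  by (auto simp: measurable_def space_F space_P sets_P)

lemma measurable_F_mono: "f \<in> measurable (F s) N \<Longrightarrow> s \<le> t \<Longrightarrow> f \<in> measurable (F t) N"
  using sets_F_mono[of s t] by (auto simp: measurable_def space_F)

lemma measurable_stopping_time_P: "stopping_time F \<tau> \<Longrightarrow> \<tau> \<in> borel_measurable (P x)"
  using sets_F_mono[of _ \<top>] by (intro measurable_stopping_time) (auto simp: space_F space_P sets_P)

lemma measurable_at_stopping_time:
  fixes Y :: "real \<Rightarrow> 'a \<Rightarrow> 'b::metric_space"
  assumes \<tau>: "stopping_time F \<tau>"
    and "\<And>t. 0 \<le> t \<Longrightarrow> Y t \<in> borel_measurable (P x)"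
    and "\<And>\<omega> t. \<omega> \<in> \<Omega> \<Longrightarrow> 0 \<le> t \<Longrightarrow> ((\<lambda>s. Y s \<omega>) \<longlongrightarrow> Y t \<omega>) (at_right t)"
  shows "(\<lambda>\<omega>. Y (enn2real (\<tau> \<omega>)) \<omega>) \<in> borel_measurable (P x)"
proof (rule measurable_right_continuous_compose[where N="P x"])
  show "(\<lambda>\<omega>. enn2real (\<tau> \<omega>)) \<in> borel_measurable (P x)"
    using measurable_stopping_time_P[OF \<tau>] by measurable
qed (use assms space_P in auto)

text \<open>The event \<open>A n k\<close> says that the rounded stopping time is
  \<open>(k + 1) / (n + 1)\<close>. Since it is known at that time, an expectation at a stopping
  time becomes a sum of expectations at fixed times over events of the past.\<close>

lemma nn_integral_upper_grid:
  fixes Z :: "real \<Rightarrow> 'a \<Rightarrow> ennreal"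
  assumes \<tau>: "stopping_time F \<tau>"
    and Z: "\<And>t. 0 \<le> t \<Longrightarrow> Z t \<in> borel_measurable (P x)"
  defines "A \<equiv> \<lambda>n k. {\<omega>\<in>\<Omega>. \<tau> \<omega> < \<top> \<and> nat \<lfloor>enn2real (\<tau> \<omega>) * real (Suc n)\<rfloor> = k}"
  shows "A n k \<in> sets (F (ennreal (real (Suc k) / real (Suc n))))"
    and "(\<integral>\<^sup>+\<omega>. (if \<tau> \<omega> < \<top> then Z (upper_grid n (enn2real (\<tau> \<omega>))) \<omega> else 0) \<partial>P x)
      = (\<Sum>k. \<integral>\<^sup>+\<omega>. Z (real (Suc k) / real (Suc n)) \<omega> * indicator (A n k) \<omega> \<partial>P x)"
proof -
  show A: "A n k \<in> sets (F (ennreal (real (Suc k) / real (Suc n))))" for k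
  proof -
    let ?s = "real (Suc k) / real (Suc n)" and ?t = "real k / real (Suc n)"
    \<comment> \<open>The stopping time lies in a half-open interval, so the event is a difference
      of two strict sublevel sets, both known at its right end.\<close>
    have "{\<omega>\<in>space (F (ennreal ?s)). \<tau> \<omega> < ennreal ?s \<and> \<not> \<tau> \<omega> < ennreal ?t} \<in> sets (F (ennreal ?s))"
    proof (rule sets.sets_Collect_conj)
      show "{\<omega>\<in>space (F (ennreal ?s)). \<tau> \<omega> < ennreal ?s} \<in> sets (F (ennreal ?s))"
        using stopping_time_less_const[OF \<tau>] by (simp add: pred_def)
      have "{\<omega>\<in>\<Omega>. \<tau> \<omega> < ennreal ?t} \<in> sets (F (ennreal ?t))"
        using stopping_time_less_const[OF \<tau>] by (simp add: pred_def space_F)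
      moreover have "sets (F (ennreal ?t)) \<subseteq> sets (F (ennreal ?s))"
        by (intro sets_F_mono ennreal_leI divide_right_mono) auto
      ultimately show "{\<omega>\<in>space (F (ennreal ?s)). \<not> \<tau> \<omega> < ennreal ?t} \<in> sets (F (ennreal ?s))"
        by (intro sets.sets_Collect_neg) (auto simp: space_F)
    qed
    also have "{\<omega>\<in>space (F (ennreal ?s)). \<tau> \<omega> < ennreal ?s \<and> \<not> \<tau> \<omega> < ennreal ?t} = A n k"
    proof -
      have "(\<tau> \<omega> < ennreal ?s \<and> \<not> \<tau> \<omega> < ennreal ?t)
          \<longleftrightarrow> (\<tau> \<omega> < \<top> \<and> nat \<lfloor>enn2real (\<tau> \<omega>) * real (Suc n)\<rfloor> = k)" for \<omega>
      proof (cases "\<tau> \<omega>")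
        case (real t)
        then have "(\<tau> \<omega> < ennreal ?s \<and> \<not> \<tau> \<omega> < ennreal ?t) \<longleftrightarrow> (t < ?s \<and> ?t \<le> t)"
          by (auto simp: ennreal_less_iff not_less simp del: of_nat_Suc)
        also have "\<dots> \<longleftrightarrow> (t * real (Suc n) < real (Suc k) \<and> real k \<le> t * real (Suc n))"
          by (simp add: pos_less_divide_eq pos_divide_le_eq del: of_nat_Suc)
        also have "\<dots> \<longleftrightarrow> \<lfloor>t * real (Suc n)\<rfloor> = int k"
          unfolding floor_eq_iff by auto
        also have "\<dots> \<longleftrightarrow> nat \<lfloor>t * real (Suc n)\<rfloor> = k"
        proof -
          have "0 \<le> \<lfloor>t * real (Suc n)\<rfloor>" using real by simp
          then show ?thesis by linarith
        qed
        finally show ?thesis using real by simp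
      qed simp
      then show ?thesis by (auto simp: A_def space_F)
    qed
    finally show ?thesis .
  qed
  then have A': "A n k \<in> sets (P x)" for k
    using sets_F_mono[OF top_greatest] by (auto simp: sets_P)
  have "(if \<tau> \<omega> < \<top> then Z (upper_grid n (enn2real (\<tau> \<omega>))) \<omega> else 0)
      = (\<Sum>k. Z (real (Suc k) / real (Suc n)) \<omega> * indicator (A n k) \<omega>)" if "\<omega> \<in> \<Omega>" for \<omega>
  proof (cases "\<tau> \<omega> < \<top>")
    case True
    let ?k = "nat \<lfloor>enn2real (\<tau> \<omega>) * real (Suc n)\<rfloor>"
    have "(\<Sum>k. Z (real (Suc k) / real (Suc n)) \<omega> * indicator (A n k) \<omega>)
        = (\<Sum>k\<in>{?k}. Z (real (Suc k) / real (Suc n)) \<omega> * indicator (A n k) \<omega>)"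
      by (rule suminf_finite) (auto simp: A_def)
    then show ?thesis using True that by (simp add: A_def upper_grid_def)
  next
    case False
    then show ?thesis by (simp add: A_def)
  qed
  then have "(\<integral>\<^sup>+\<omega>. (if \<tau> \<omega> < \<top> then Z (upper_grid n (enn2real (\<tau> \<omega>))) \<omega> else 0) \<partial>P x)
      = (\<integral>\<^sup>+\<omega>. (\<Sum>k. Z (real (Suc k) / real (Suc n)) \<omega> * indicator (A n k) \<omega>) \<partial>P x)"
    by (intro nn_integral_cong) (simp add: space_P)
  also have "\<dots> = (\<Sum>k. \<integral>\<^sup>+\<omega>. Z (real (Suc k) / real (Suc n)) \<omega> * indicator (A n k) \<omega> \<partial>P x)"
    using A' by (intro nn_integral_suminf borel_measurable_times_ennreal Z) auto
  finally show "(\<integral>\<^sup>+\<omega>. (if \<tau> \<omega> < \<top> then Z (upper_grid n (enn2real (\<tau> \<omega>))) \<omega> else 0) \<partial>P x)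
      = (\<Sum>k. \<integral>\<^sup>+\<omega>. Z (real (Suc k) / real (Suc n)) \<omega> * indicator (A n k) \<omega> \<partial>P x)" .
qed

text \<open>The rounded times approach the stopping time from the right; the finite constant
  \<open>c\<close> dominates on a probability space.\<close>

lemma nn_integral_upper_grid_tendsto:
  fixes Z :: "real \<Rightarrow> 'a \<Rightarrow> ennreal"
  assumes \<tau>: "stopping_time F \<tau>"
    and Z: "\<And>t. 0 \<le> t \<Longrightarrow> Z t \<in> borel_measurable (P x)"
    and rc: "\<And>\<omega> t. \<omega> \<in> \<Omega> \<Longrightarrow> 0 \<le> t \<Longrightarrow> ((\<lambda>s. Z s \<omega>) \<longlongrightarrow> Z t \<omega>) (at_right t)"
    and bound: "\<And>\<omega> t. \<omega> \<in> \<Omega> \<Longrightarrow> 0 \<le> t \<Longrightarrow> Z t \<omega> \<le> c" and c: "c < \<infinity>"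
  shows "(\<lambda>n. \<integral>\<^sup>+\<omega>. (if \<tau> \<omega> < \<top> then Z (upper_grid n (enn2real (\<tau> \<omega>))) \<omega> else 0) \<partial>P x)
    \<longlonglongrightarrow> (\<integral>\<^sup>+\<omega>. (if \<tau> \<omega> < \<top> then Z (enn2real (\<tau> \<omega>)) \<omega> else 0) \<partial>P x)"
proof (rule nn_integral_dominated_convergence[where w="\<lambda>_. c"])
  note [measurable] = measurable_stopping_time_P[OF \<tau>]
  have Z_grid: "(\<lambda>\<omega>. Z (upper_grid n (enn2real (\<tau> \<omega>))) \<omega>) \<in> borel_measurable (P x)" for n
    unfolding upper_grid_def
    by (rule measurable_compose_countable[where f="\<lambda>k. Z (real (Suc k) / real (Suc n))"])
      (auto intro!: Z)
  then show "(\<lambda>\<omega>. if \<tau> \<omega> < \<top> then Z (upper_grid n (enn2real (\<tau> \<omega>))) \<omega> else 0) \<in> borel_measurable (P x)" for n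
    by measurable
  have lim: "(\<lambda>n. Z (upper_grid n (enn2real (\<tau> \<omega>))) \<omega>) \<longlonglongrightarrow> Z (enn2real (\<tau> \<omega>)) \<omega>" if "\<omega> \<in> \<Omega>" for \<omega>
    by (rule right_limit_sequentially[where f="\<lambda>t. Z t \<omega>"])
      (auto intro!: rc that upper_grid_tendsto less_imp_le[OF upper_grid_bounds(1)])
  have "(\<lambda>\<omega>. Z (enn2real (\<tau> \<omega>)) \<omega>) \<in> borel_measurable (P x)"
    by (rule borel_measurable_LIMSEQ_order[OF _ Z_grid]) (use lim in \<open>auto simp: space_P\<close>)
  then show "(\<lambda>\<omega>. if \<tau> \<omega> < \<top> then Z (enn2real (\<tau> \<omega>)) \<omega> else 0) \<in> borel_measurable (P x)"
    by measurable
  interpret prob_space "P x" by (rule prob_space_P)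
  show "(\<integral>\<^sup>+\<omega>. c \<partial>P x) < \<infinity>" using c by (simp add: emeasure_space_1)
  show "AE \<omega> in P x. (if \<tau> \<omega> < \<top> then Z (upper_grid n (enn2real (\<tau> \<omega>))) \<omega> else 0) \<le> c" for n
    by (rule AE_I2) (auto intro!: bound simp: space_P upper_grid_def)
  show "AE \<omega> in P x. (\<lambda>n. if \<tau> \<omega> < \<top> then Z (upper_grid n (enn2real (\<tau> \<omega>))) \<omega> else 0)
      \<longlonglongrightarrow> (if \<tau> \<omega> < \<top> then Z (enn2real (\<tau> \<omega>)) \<omega> else 0)"
    using lim by (intro AE_I2) (auto simp: space_P)
qed simp

text \<open>This carries an identity from fixed times to stopping times. It holds on each event
  where the rounded time takes a given value, and then in the limit of finer grids. It serves the
  strong Markov property as well as the increments after a stopping time.\<close>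

lemma nn_integral_stopping_time_cong:
  fixes Z W :: "real \<Rightarrow> 'a \<Rightarrow> ennreal"
  assumes \<tau>: "stopping_time F \<tau>"
    and Z: "\<And>t. 0 \<le> t \<Longrightarrow> Z t \<in> borel_measurable (P x)"
      "\<And>\<omega> t. \<omega> \<in> \<Omega> \<Longrightarrow> 0 \<le> t \<Longrightarrow> ((\<lambda>s. Z s \<omega>) \<longlongrightarrow> Z t \<omega>) (at_right t)"
      "\<And>\<omega> t. \<omega> \<in> \<Omega> \<Longrightarrow> 0 \<le> t \<Longrightarrow> Z t \<omega> \<le> c"
    and W: "\<And>t. 0 \<le> t \<Longrightarrow> W t \<in> borel_measurable (P x)"
      "\<And>\<omega> t. \<omega> \<in> \<Omega> \<Longrightarrow> 0 \<le> t \<Longrightarrow> ((\<lambda>s. W s \<omega>) \<longlongrightarrow> W t \<omega>) (at_right t)"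
      "\<And>\<omega> t. \<omega> \<in> \<Omega> \<Longrightarrow> 0 \<le> t \<Longrightarrow> W t \<omega> \<le> c"
    and c: "c < \<infinity>"
    and eq: "\<And>t A. 0 \<le> t \<Longrightarrow> A \<in> sets (F (ennreal t)) \<Longrightarrow>
      (\<integral>\<^sup>+\<omega>. Z t \<omega> * indicator A \<omega> \<partial>P x) = (\<integral>\<^sup>+\<omega>. W t \<omega> * indicator A \<omega> \<partial>P x)"
  shows "(\<integral>\<^sup>+\<omega>. (if \<tau> \<omega> < \<top> then Z (enn2real (\<tau> \<omega>)) \<omega> else 0) \<partial>P x)
    = (\<integral>\<^sup>+\<omega>. (if \<tau> \<omega> < \<top> then W (enn2real (\<tau> \<omega>)) \<omega> else 0) \<partial>P x)"
proof -
  define A where "A n k = {\<omega>\<in>\<Omega>. \<tau> \<omega> < \<top> \<and> nat \<lfloor>enn2real (\<tau> \<omega>) * real (Suc n)\<rfloor> = k}" for n k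
  have A: "A n k \<in> sets (F (ennreal (real (Suc k) / real (Suc n))))" for n k
    unfolding A_def by (rule nn_integral_upper_grid(1)[OF \<tau> Z(1)])
  have "(\<integral>\<^sup>+\<omega>. (if \<tau> \<omega> < \<top> then Z (upper_grid n (enn2real (\<tau> \<omega>))) \<omega> else 0) \<partial>P x)
      = (\<integral>\<^sup>+\<omega>. (if \<tau> \<omega> < \<top> then W (upper_grid n (enn2real (\<tau> \<omega>))) \<omega> else 0) \<partial>P x)" for n
  proof -
    have "(\<integral>\<^sup>+\<omega>. (if \<tau> \<omega> < \<top> then Z (upper_grid n (enn2real (\<tau> \<omega>))) \<omega> else 0) \<partial>P x)
        = (\<Sum>k. \<integral>\<^sup>+\<omega>. Z (real (Suc k) / real (Suc n)) \<omega> * indicator (A n k) \<omega> \<partial>P x)"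
      unfolding A_def by (rule nn_integral_upper_grid(2)[OF \<tau> Z(1)])
    also have "\<dots> = (\<Sum>k. \<integral>\<^sup>+\<omega>. W (real (Suc k) / real (Suc n)) \<omega> * indicator (A n k) \<omega> \<partial>P x)"
      by (intro suminf_cong eq A) simp
    also have "\<dots> = (\<integral>\<^sup>+\<omega>. (if \<tau> \<omega> < \<top> then W (upper_grid n (enn2real (\<tau> \<omega>))) \<omega> else 0) \<partial>P x)"
      unfolding A_def by (rule nn_integral_upper_grid(2)[OF \<tau> W(1), symmetric])
    finally show ?thesis .
  qed
  then show ?thesis
    using nn_integral_upper_grid_tendsto[OF \<tau> Z c]
    by (intro LIMSEQ_unique[OF _ nn_integral_upper_grid_tendsto[OF \<tau> W c]]) simp_all
qed

end

text \<open>The general case is reduced to this one by changing the process on a null set.\<close>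
locale regular_levy_process = levy_process \<Omega> F P X
  for \<Omega> :: "'a set" and F :: "ennreal \<Rightarrow> 'a measure" and P :: "real \<Rightarrow> 'a measure"
    and X :: "real \<Rightarrow> 'a \<Rightarrow> real" +
  assumes paths: "\<And>\<omega>. \<omega> \<in> \<Omega> \<Longrightarrow> cadlag (\<lambda>t. X t \<omega>)"

context levy_process
begin

lemma measurable_X: "0 \<le> t \<Longrightarrow> X t \<in> borel_measurable (P x)"
  by (rule measurable_F_P[OF adapted])

text \<open>The only place where independence and stationarity of increments enter together: the
  past \<open>H\<close> is frozen, and the increment is integrated against its law under
  \<open>P 0\<close>.\<close>

lemma nn_integral_increment:
  assumes s: "0 \<le> s" "0 \<le> h" and H: "H \<in> measurable (F (ennreal s)) N"
    and f: "f \<in> borel_measurable (N \<Otimes>\<^sub>M borel)"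
  shows "(\<integral>\<^sup>+\<omega>. f (H \<omega>, X (s + h) \<omega> - X s \<omega>) \<partial>P x)
    = (\<integral>\<^sup>+\<omega>. \<integral>\<^sup>+\<omega>'. f (H \<omega>, X h \<omega>' - X 0 \<omega>') \<partial>P 0 \<partial>P x)"
proof -
  interpret x: prob_space "P x" by (rule prob_space_P)
  interpret o: prob_space "P 0" by (rule prob_space_P)
  show ?thesis
  proof (cases "h = 0")
    \<comment> \<open>Independence is given for \<open>s < t\<close> only; for \<open>h = 0\<close>
      both increments vanish identically.\<close>
    case True
    then show ?thesis by (simp add: o.emeasure_space_1)
  next
    case False
    have "(\<integral>\<^sup>+\<omega>. f (H \<omega>, X (s + h) \<omega> - X s \<omega>) \<partial>P x)
        = (\<integral>\<^sup>+\<omega>. \<integral>\<^sup>+\<omega>'. f (H \<omega>, X (s + h) \<omega>' - X s \<omega>') \<partial>P x \<partial>P x)"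
    proof (rule x.nn_integral_indep[OF _ _ _ _ _ f])
      show "x.indep_set (sets (F (ennreal s)))
          (sets (vimage_algebra \<Omega> (\<lambda>\<omega>. X (s + h) \<omega> - X s \<omega>) borel))"
        using independent_increments[of s "s + h" x] s False by simp
      show "H \<in> measurable (P x) N" by (rule measurable_F_P[OF H])
      show "(\<lambda>\<omega>. X (s + h) \<omega> - X s \<omega>) \<in> borel_measurable (P x)"
        using s by (intro borel_measurable_diff measurable_X) auto
    qed (use measurable_sets[OF H] in \<open>auto simp: space_P space_F intro: in_vimage_algebra\<close>)
    also have "\<dots> = (\<integral>\<^sup>+\<omega>. \<integral>\<^sup>+\<omega>'. f (H \<omega>, X h \<omega>' - X 0 \<omega>') \<partial>P 0 \<partial>P x)"
    proof (rule nn_integral_cong)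
      fix \<omega> assume "\<omega> \<in> space (P x)"
      then have "H \<omega> \<in> space N" using measurable_space[OF H] by (simp add: space_P space_F)
      then have g: "(\<lambda>z. f (H \<omega>, z)) \<in> borel_measurable borel" using f by measurable
      have [measurable]: "X (s + h) \<in> borel_measurable (P x)" "X s \<in> borel_measurable (P x)"
        "X h \<in> borel_measurable (P 0)" "X 0 \<in> borel_measurable (P 0)"
        using s by (auto intro!: measurable_X)
      have "(\<integral>\<^sup>+\<omega>'. f (H \<omega>, X (s + h) \<omega>' - X s \<omega>') \<partial>P x)
          = (\<integral>\<^sup>+z. f (H \<omega>, z) \<partial>distr (P x) borel (\<lambda>\<omega>. X (s + h) \<omega> - X s \<omega>))"
        using g by (subst nn_integral_distr) auto
      also have "\<dots> = (\<integral>\<^sup>+\<omega>'. f (H \<omega>, X h \<omega>' - X 0 \<omega>') \<partial>P 0)"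
        unfolding stationary_increments[OF s] using g by (subst nn_integral_distr) auto
      finally show "(\<integral>\<^sup>+\<omega>'. f (H \<omega>, X (s + h) \<omega>' - X s \<omega>') \<partial>P x)
          = (\<integral>\<^sup>+\<omega>'. f (H \<omega>, X h \<omega>' - X 0 \<omega>') \<partial>P 0)" .
    qed
    finally show ?thesis .
  qed
qed

end

section \<open>The strong Markov property\<close>

lemma tendsto_path_compose:
  fixes q :: "real \<Rightarrow> ennreal" and f :: "real \<Rightarrow> real"
  assumes q: "continuous_on UNIV q" and f: "\<And>t. 0 \<le> t \<Longrightarrow> (f \<longlongrightarrow> f t) (at_right t)"
    and "0 \<le> s" "0 \<le> t"
  shows "((\<lambda>t. q (c + f (s + t))) \<longlongrightarrow> q (c + f (s + t))) (at_right t)"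
proof -
  have "((\<lambda>t. f (t + s)) \<longlongrightarrow> f (t + s)) (at_right t)"
    using assms by (intro tendsto_at_right_shift f) auto
  then have "((\<lambda>t. c + f (s + t)) \<longlongrightarrow> c + f (s + t)) (at_right t)"
    by (intro tendsto_intros) (simp add: ac_simps)
  moreover have "isCont q (c + f (s + t))"
    using q by (simp add: continuous_on_eq_continuous_at)
  ultimately show ?thesis by (rule isCont_tendsto_compose[rotated])
qed

lemma borel_measurable_grid_sup:
  assumes "\<And>k. (\<lambda>z. f z (real k * (u z / 2 ^ n))) \<in> borel_measurable M"
  shows "(\<lambda>z. grid_sup (f z) (u z) n) \<in> borel_measurable M"
  unfolding grid_sup_def
  by (intro borel_measurable_SUP borel_measurable_min assms) auto

text \<open>The uncountable supremum is a countable one of grid maxima. The horizon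
  \<open>T\<close>, the starting time \<open>S\<close> and the shift \<open>c\<close> depend on
  \<open>z\<close>, so that this one statement gives the joint measurability that the uses of
  Fubini's theorem require.\<close>

lemma borel_measurable_path_sup:
  fixes Y :: "real \<Rightarrow> 'a \<Rightarrow> real" and q :: "real \<Rightarrow> ennreal"
  assumes Y: "\<And>t. 0 \<le> t \<Longrightarrow> Y t \<in> borel_measurable N"
    and rc: "\<And>\<omega> t. \<omega> \<in> space N \<Longrightarrow> 0 \<le> t \<Longrightarrow> ((\<lambda>s. Y s \<omega>) \<longlongrightarrow> Y t \<omega>) (at_right t)"
    and q: "continuous_on UNIV q"
    and [measurable]: "T \<in> borel_measurable M" "S \<in> borel_measurable M" "c \<in> borel_measurable M"
    and pos: "\<And>z. z \<in> space M \<Longrightarrow> 0 \<le> T z" "\<And>z. z \<in> space M \<Longrightarrow> 0 \<le> S z"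
    and W: "W \<in> measurable M N"
  shows "(\<lambda>z. SUP t\<in>{0..T z}. q (c z + Y (S z + t) (W z))) \<in> borel_measurable M"
proof -
  note [measurable] = borel_measurable_continuous_onI[OF q]
  have "(\<lambda>z. Y (S z + real k * (T z / 2 ^ n)) (W z)) \<in> borel_measurable M" for n k
    using pos by (intro measurable_right_continuous_compose[OF Y rc _ _ W]) auto
  then have "(\<lambda>z. SUP n. grid_sup (\<lambda>t. q (c z + Y (S z + t) (W z))) (T z) n) \<in> borel_measurable M"
    by (intro borel_measurable_SUP borel_measurable_grid_sup) measurable
  moreover have "(SUP n. grid_sup (\<lambda>t. q (c z + Y (S z + t) (W z))) (T z) n)
      = (SUP t\<in>{0..T z}. q (c z + Y (S z + t) (W z)))" if "z \<in> space M" for z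
    using that pos measurable_space[OF W that]
    by (intro SUP_grid_sup tendsto_path_compose[OF q, where f="\<lambda>t. Y t (W z)"] rc) auto
  ultimately show ?thesis by (simp cong: measurable_cong)
qed

section \<open>The Markov property for maxima over a finite grid\<close>

context levy_process
begin

text \<open>Backward recursion along the grid: \<open>a\<close> is the maximum of \<open>\<phi>\<close> recorded so far and \<open>y\<close> the
  current position.\<close>
primrec grid_value :: "(real \<Rightarrow> ennreal) \<Rightarrow> real \<Rightarrow> nat \<Rightarrow> ennreal \<Rightarrow> real \<Rightarrow> ennreal" where
  "grid_value \<phi> h 0 a y = a"
| "grid_value \<phi> h (Suc m) a y = (\<integral>\<^sup>+\<omega>. grid_value \<phi> h m
      (sup a (\<phi> (y + (X h \<omega> - X 0 \<omega>)))) (y + (X h \<omega> - X 0 \<omega>)) \<partial>P 0)"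

lemma borel_measurable_grid_value:
  assumes [measurable]: "\<phi> \<in> borel_measurable borel" and h: "0 \<le> h"
  shows "(\<lambda>(a, y). grid_value \<phi> h m a y) \<in> borel_measurable (borel \<Otimes>\<^sub>M borel)"
proof (induction m)
  case (Suc m)
  note [measurable] = Suc measurable_X[OF h] measurable_X[OF order_refl]
  interpret prob_space "P 0" by (rule prob_space_P)
  show ?case by simp measurable
qed simp

text \<open>Only increments enter the recursion. Hence a path from 0 shifted by \<open>c\<close> has
  the same value as a path started at the shifted position.\<close>

lemma grid_value_translate:
  "grid_value \<phi> h m a (c + y) = grid_value (\<lambda>z. \<phi> (c + z)) h m a y"
  by (induction m arbitrary: a y) (simp_all add: add.assoc)

text \<open>Induction on the number of nodes, with \<open>s\<close> and the record \<open>A\<close>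
  general, because each step advances the time and updates the record. The weight \<open>B\<close>
  will carry the discount factor and an event of the past.\<close>

lemma markov_grid_value:
  assumes \<phi> [measurable]: "\<phi> \<in> borel_measurable borel" and h: "0 \<le> h" and "0 \<le> s"
    and "A \<in> borel_measurable (F (ennreal s))" "B \<in> borel_measurable (F (ennreal s))"
  shows "(\<integral>\<^sup>+\<omega>. B \<omega> * sup (A \<omega>) (SUP k\<in>{..<m}. \<phi> (X (s + real (Suc k) * h) \<omega>)) \<partial>P x)
    = (\<integral>\<^sup>+\<omega>. B \<omega> * grid_value \<phi> h m (A \<omega>) (X s \<omega>) \<partial>P x)"
  using assms(3-)
proof (induction m arbitrary: s A)
  case 0
  then show ?case by (simp add: bot_ennreal sup_absorb1)
next
  case (Suc m)
  note [measurable] = Suc.prems(2,3) adapted[OF \<open>0 \<le> s\<close>] borel_measurable_grid_value[OF \<phi> h]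
  interpret o: prob_space "P 0" by (rule prob_space_P)
  let ?A = "\<lambda>\<omega>. sup (A \<omega>) (\<phi> (X (s + h) \<omega>))"
  let ?f = "\<lambda>p. fst (fst p) * grid_value \<phi> h m
    (sup (fst (snd (fst p))) (\<phi> (snd (snd (fst p)) + snd p))) (snd (snd (fst p)) + snd p)"
  have le: "ennreal s \<le> ennreal (s + h)" using h Suc.prems by (intro ennreal_leI) auto
  \<comment> \<open>The first node moves from the supremum into the record; the other
    \<open>m\<close> nodes are seen from time \<open>s + h\<close>.\<close>
  have "B \<omega> * sup (A \<omega>) (SUP k\<in>{..<Suc m}. \<phi> (X (s + real (Suc k) * h) \<omega>))
      = B \<omega> * sup (?A \<omega>) (SUP k\<in>{..<m}. \<phi> (X ((s + h) + real (Suc k) * h) \<omega>))" for \<omega>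
    unfolding lessThan_Suc_eq_insert_0
    by (simp add: sup_assoc image_comp o_def distrib_right add.assoc)
  then have "(\<integral>\<^sup>+\<omega>. B \<omega> * sup (A \<omega>) (SUP k\<in>{..<Suc m}. \<phi> (X (s + real (Suc k) * h) \<omega>)) \<partial>P x)
      = (\<integral>\<^sup>+\<omega>. B \<omega> * sup (?A \<omega>) (SUP k\<in>{..<m}. \<phi> (X ((s + h) + real (Suc k) * h) \<omega>)) \<partial>P x)"
    by simp
  also have "\<dots> = (\<integral>\<^sup>+\<omega>. B \<omega> * grid_value \<phi> h m (?A \<omega>) (X (s + h) \<omega>) \<partial>P x)"
  proof (rule Suc.IH)
    show "?A \<in> borel_measurable (F (ennreal (s + h)))"
      using h Suc.prems le measurable_F_mono[OF Suc.prems(2) le]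
      by (intro borel_measurable_sup measurable_compose[OF adapted \<phi>]) auto
    show "B \<in> borel_measurable (F (ennreal (s + h)))"
      by (rule measurable_F_mono[OF Suc.prems(3) le])
  qed (use h Suc.prems in auto)
  also have "\<dots> = (\<integral>\<^sup>+\<omega>. ?f
      ((B \<omega>, A \<omega>, X s \<omega>), X (s + h) \<omega> - X s \<omega>) \<partial>P x)"
    by simp
  also have "\<dots> = (\<integral>\<^sup>+\<omega>. \<integral>\<^sup>+\<omega>'. ?f
      ((B \<omega>, A \<omega>, X s \<omega>), X h \<omega>' - X 0 \<omega>') \<partial>P 0 \<partial>P x)"
    by (rule nn_integral_increment[OF \<open>0 \<le> s\<close> h, where N="borel \<Otimes>\<^sub>M borel \<Otimes>\<^sub>M borel"]) measurable
  also have "\<dots> = (\<integral>\<^sup>+\<omega>. B \<omega> * grid_value \<phi> h (Suc m) (A \<omega>) (X s \<omega>) \<partial>P x)"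
  proof -
    note [measurable] = measurable_X[OF h] measurable_X[OF order_refl]
    have "(\<lambda>\<omega>. grid_value \<phi> h m (sup a (\<phi> (y + (X h \<omega> - X 0 \<omega>)))) (y + (X h \<omega> - X 0 \<omega>)))
        \<in> borel_measurable (P 0)" for a y
      by measurable
    then show ?thesis by (simp add: nn_integral_cmult)
  qed
  finally show ?case .
qed

end

section \<open>From grids at fixed times to suprema after a stopping time\<close>

context regular_levy_process
begin

lemma path_right_continuous:
  "\<omega> \<in> \<Omega> \<Longrightarrow> 0 \<le> t \<Longrightarrow> ((\<lambda>s. X s \<omega>) \<longlongrightarrow> X t \<omega>) (at_right t)"
  using paths by (auto simp: cadlag_def continuous_within)

text \<open>The path is shifted by \<open>y\<close> under \<open>P 0\<close> instead of being taken
  under \<open>P y\<close>. In this way \<open>y\<close> is an ordinary parameter, and continuity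
  and measurability in \<open>y\<close> can be proved, although \<open>P y\<close> is an arbitrary
  family in \<open>y\<close> apart from the law of its increments and its starting point.\<close>

definition grid_sup_mean :: "(real \<Rightarrow> ennreal) \<Rightarrow> real \<Rightarrow> nat \<Rightarrow> real \<Rightarrow> ennreal" where
  "grid_sup_mean q u n y = (\<integral>\<^sup>+\<omega>. grid_sup (\<lambda>t. q (y + X t \<omega>)) u n \<partial>P 0)"

definition sup_mean :: "(real \<Rightarrow> ennreal) \<Rightarrow> real \<Rightarrow> real \<Rightarrow> ennreal" where
  "sup_mean q u y = (\<integral>\<^sup>+\<omega>. (SUP t\<in>{0..u}. q (y + X t \<omega>)) \<partial>P 0)"

text \<open>Both sides are evaluated by the same recursion \<open>grid_value\<close>, applied to the
  truncation of \<open>q\<close>.\<close>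

lemma markov_grid_sup:
  assumes q: "continuous_on UNIV q" and u: "0 \<le> u" and s: "0 \<le> s"
    and B: "B \<in> borel_measurable (F (ennreal s))"
  shows "(\<integral>\<^sup>+\<omega>. B \<omega> * grid_sup (\<lambda>t. q (X (s + t) \<omega>)) u n \<partial>P x)
    = (\<integral>\<^sup>+\<omega>. B \<omega> * grid_sup_mean q u n (X s \<omega>) \<partial>P x)"
proof -
  note [measurable] = borel_measurable_continuous_onI[OF q]
  define h where "h = u / 2 ^ n"
  define \<phi> where "\<phi> y = min (q y) (of_nat n)" for y
  have h: "0 \<le> h" using u by (simp add: h_def)
  have \<phi> [measurable]: "\<phi> \<in> borel_measurable borel" unfolding \<phi>_def by measurable
  \<comment> \<open>The recursion is used at time 0 under \<open>P 0\<close>. There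
    \<open>X 0 = 0\<close> almost surely, so record and position are constants, and the shift by
    \<open>y\<close> is absorbed by translation.\<close>
  have mean: "grid_sup_mean q u n y = grid_value \<phi> h (2 ^ n) (\<phi> y) y" for y
  proof -
    interpret prob_space "P 0" by (rule prob_space_P)
    have "grid_sup_mean q u n y = (\<integral>\<^sup>+\<omega>. 1 * sup (\<phi> (y + X 0 \<omega>))
        (SUP k\<in>{..<2 ^ n}. \<phi> (y + X (0 + real (Suc k) * h) \<omega>)) \<partial>P 0)"
      by (simp add: grid_sup_mean_def grid_sup_eq \<phi>_def h_def)
    also have "\<dots> = (\<integral>\<^sup>+\<omega>. 1 * grid_value (\<lambda>z. \<phi> (y + z)) h (2 ^ n) (\<phi> (y + X 0 \<omega>)) (X 0 \<omega>) \<partial>P 0)"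
      using adapted[of 0] h by (intro markov_grid_value) auto
    also have "\<dots> = (\<integral>\<^sup>+\<omega>. grid_value (\<lambda>z. \<phi> (y + z)) h (2 ^ n) (\<phi> (y + 0)) 0 \<partial>P 0)"
      using starts_at[of 0] by (intro nn_integral_cong_AE) auto
    also have "\<dots> = grid_value \<phi> h (2 ^ n) (\<phi> y) y"
      using grid_value_translate[of \<phi> h "2 ^ n" "\<phi> y" y 0] by (simp add: emeasure_space_1)
    finally show ?thesis .
  qed
  have "(\<integral>\<^sup>+\<omega>. B \<omega> * grid_sup (\<lambda>t. q (X (s + t) \<omega>)) u n \<partial>P x)
      = (\<integral>\<^sup>+\<omega>. B \<omega> * sup (\<phi> (X s \<omega>)) (SUP k\<in>{..<2 ^ n}. \<phi> (X (s + real (Suc k) * h) \<omega>)) \<partial>P x)"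
    by (simp add: grid_sup_eq \<phi>_def h_def)
  also have "\<dots> = (\<integral>\<^sup>+\<omega>. B \<omega> * grid_value \<phi> h (2 ^ n) (\<phi> (X s \<omega>)) (X s \<omega>) \<partial>P x)"
    by (intro markov_grid_value \<phi> h s B measurable_compose[OF adapted \<phi>])
  finally show ?thesis by (simp add: mean)
qed

lemma grid_sup_mean_le: "grid_sup_mean q u n y \<le> of_nat n"
proof -
  interpret prob_space "P 0" by (rule prob_space_P)
  have "grid_sup_mean q u n y \<le> (\<integral>\<^sup>+\<omega>. of_nat n \<partial>P 0)"
    unfolding grid_sup_mean_def by (intro nn_integral_mono grid_sup_le)
  then show ?thesis by (simp add: emeasure_space_1)
qed

text \<open>A finite maximum of continuous functions bounded by \<open>n\<close> passes through
  dominated convergence. Continuity makes the mean right-continuous along paths, as the passage to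
  stopping times requires.\<close>

lemma continuous_grid_sup_mean:
  assumes q: "continuous_on UNIV q" and u: "0 \<le> u"
  shows "continuous_on UNIV (grid_sup_mean q u n)"
proof -
  note [measurable] = borel_measurable_continuous_onI[OF q]
  interpret prob_space "P 0" by (rule prob_space_P)
  have "isCont (grid_sup_mean q u n) y" for y
    unfolding continuous_at_sequentially comp_def
  proof (intro allI impI)
    fix z assume z: "z \<longlonglongrightarrow> y"
    show "(\<lambda>i. grid_sup_mean q u n (z i)) \<longlonglongrightarrow> grid_sup_mean q u n y"
      unfolding grid_sup_mean_def
    proof (rule nn_integral_dominated_convergence[where w="\<lambda>_. of_nat n"])
      have [measurable]: "X (real k * (u / 2 ^ n)) \<in> borel_measurable (P 0)" for k
        using u by (intro measurable_X) simp
      show "(\<lambda>\<omega>. grid_sup (\<lambda>t. q (z i + X t \<omega>)) u n) \<in> borel_measurable (P 0)" for i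
        by (intro borel_measurable_grid_sup) measurable
      show "(\<lambda>\<omega>. grid_sup (\<lambda>t. q (y + X t \<omega>)) u n) \<in> borel_measurable (P 0)"
        by (intro borel_measurable_grid_sup) measurable
      show "AE \<omega> in P 0. (\<lambda>i. grid_sup (\<lambda>t. q (z i + X t \<omega>)) u n) \<longlonglongrightarrow> grid_sup (\<lambda>t. q (y + X t \<omega>)) u n"
      proof (rule AE_I2)
        fix \<omega>
        have "isCont q v" for v using q by (simp add: continuous_on_eq_continuous_at)
        then show "(\<lambda>i. grid_sup (\<lambda>t. q (z i + X t \<omega>)) u n) \<longlonglongrightarrow> grid_sup (\<lambda>t. q (y + X t \<omega>)) u n"
          unfolding grid_sup_def
          by (intro tendsto_SUP_finite tendsto_min isCont_tendsto_compose[of _ q] tendsto_intros z) auto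
      qed
    qed (auto simp: grid_sup_le emeasure_space_1 of_nat_less_top)
  qed
  then show ?thesis by (simp add: continuous_on_eq_continuous_at)
qed

text \<open>Both integrands are right-continuous in time and bounded by \<open>n\<close>. At a fixed
  time the identity is the Markov property, with the discount factor times an indicator as
  weight.\<close>

lemma strong_markov_grid_sup:
  assumes r: "0 \<le> r" and q: "continuous_on UNIV q" and u: "0 \<le> u" and \<tau>: "stopping_time F \<tau>"
  shows "(\<integral>\<^sup>+\<omega>. (if \<tau> \<omega> < \<top> then ennreal (exp (- r * enn2real (\<tau> \<omega>)))
        * grid_sup (\<lambda>t. q (X (enn2real (\<tau> \<omega>) + t) \<omega>)) u n else 0) \<partial>P x)
    = (\<integral>\<^sup>+\<omega>. (if \<tau> \<omega> < \<top> then ennreal (exp (- r * enn2real (\<tau> \<omega>)))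
        * grid_sup_mean q u n (X (enn2real (\<tau> \<omega>)) \<omega>) else 0) \<partial>P x)"
proof -
  note [measurable] = borel_measurable_continuous_onI[OF q]
    borel_measurable_continuous_onI[OF continuous_grid_sup_mean[OF q u]]
  let ?e = "\<lambda>s. ennreal (exp (- r * s))"
  have e: "(?e \<longlongrightarrow> ?e t) (at_right t)" for t
    by (intro tendsto_intros tendsto_ennrealI)
  have e1: "?e t * c \<le> of_nat n" if "0 \<le> t" "c \<le> of_nat n" for t c
  proof -
    have "?e t * c \<le> ennreal 1 * of_nat n"
      using r that by (intro mult_mono ennreal_leI) auto
    then show ?thesis by simp
  qed
  have fin: "c < \<top>" if "c \<le> (of_nat n :: ennreal)" for c
    using that by (rule order.strict_trans1) (simp add: of_nat_less_top)
  have X [measurable]: "X (t + real k * (u / 2 ^ n)) \<in> borel_measurable (P x)" if "0 \<le> t" for t k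
    using u that by (intro measurable_X) simp
  show ?thesis
  proof (rule nn_integral_stopping_time_cong[OF \<tau>, where c="of_nat n"
        and Z="\<lambda>s \<omega>. ?e s * grid_sup (\<lambda>t. q (X (s + t) \<omega>)) u n"
        and W="\<lambda>s \<omega>. ?e s * grid_sup_mean q u n (X s \<omega>)"])
    fix t :: real assume t: "0 \<le> t"
    show "(\<lambda>\<omega>. ?e t * grid_sup (\<lambda>s. q (X (t + s) \<omega>)) u n) \<in> borel_measurable (P x)"
      using t by (intro borel_measurable_times_ennreal borel_measurable_grid_sup) measurable
    show "(\<lambda>\<omega>. ?e t * grid_sup_mean q u n (X t \<omega>)) \<in> borel_measurable (P x)"
      using measurable_X[OF t] by measurable
    fix \<omega> assume \<omega>: "\<omega> \<in> \<Omega>"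
    have "((\<lambda>s. q (X (s + c) \<omega>)) \<longlongrightarrow> q (X (t + c) \<omega>)) (at_right t)" if "0 \<le> c" for c
      using tendsto_path_compose[OF q path_right_continuous[OF \<omega>] that t, of 0] by (simp add: ac_simps)
    then have "((\<lambda>s. grid_sup (\<lambda>c. q (X (s + c) \<omega>)) u n) \<longlongrightarrow> grid_sup (\<lambda>c. q (X (t + c) \<omega>)) u n) (at_right t)"
      unfolding grid_sup_def using u by (intro tendsto_SUP_finite tendsto_min) auto
    then show "((\<lambda>s. ?e s * grid_sup (\<lambda>c. q (X (s + c) \<omega>)) u n)
        \<longlongrightarrow> ?e t * grid_sup (\<lambda>c. q (X (t + c) \<omega>)) u n) (at_right t)"
      \<comment> \<open>Multiplication in [0,\<infinity>] is continuous except at the products of 0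
        and \<infinity>, which the truncation rules out.\<close>
      using fin[OF grid_sup_le] by (intro tendsto_mult_ennreal e) (auto simp: less_top)
    have "isCont (grid_sup_mean q u n) (X t \<omega>)"
      using continuous_grid_sup_mean[OF q u] by (simp add: continuous_on_eq_continuous_at)
    then have "((\<lambda>s. grid_sup_mean q u n (X s \<omega>)) \<longlongrightarrow> grid_sup_mean q u n (X t \<omega>)) (at_right t)"
      by (rule isCont_tendsto_compose) (rule path_right_continuous[OF \<omega> t])
    then show "((\<lambda>s. ?e s * grid_sup_mean q u n (X s \<omega>)) \<longlongrightarrow> ?e t * grid_sup_mean q u n (X t \<omega>)) (at_right t)"
      using fin[OF grid_sup_mean_le] by (intro tendsto_mult_ennreal e) (auto simp: less_top)
    show "?e t * grid_sup (\<lambda>s. q (X (t + s) \<omega>)) u n \<le> of_nat n" "?e t * grid_sup_mean q u n (X t \<omega>) \<le> of_nat n"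
      by (rule e1[OF t grid_sup_le], rule e1[OF t grid_sup_mean_le])
  next
    fix t A assume t: "0 \<le> t" and A: "A \<in> sets (F (ennreal t))"
    then show "(\<integral>\<^sup>+\<omega>. ?e t * grid_sup (\<lambda>s. q (X (t + s) \<omega>)) u n * indicator A \<omega> \<partial>P x)
        = (\<integral>\<^sup>+\<omega>. ?e t * grid_sup_mean q u n (X t \<omega>) * indicator A \<omega> \<partial>P x)"
      using markov_grid_sup[OF q u t, where B="\<lambda>\<omega>. ?e t * indicator A \<omega>"] by (simp add: ac_simps)
  qed (simp add: of_nat_less_top)
qed

lemma SUP_grid_sup_mean:
  assumes q: "continuous_on UNIV q" and u: "0 \<le> u"
  shows "(SUP n. grid_sup_mean q u n y) = sup_mean q u y"
proof -
  note [measurable] = borel_measurable_continuous_onI[OF q]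
  have [measurable]: "X (real k * (u / 2 ^ n)) \<in> borel_measurable (P 0)" for k n
    using u by (intro measurable_X) simp
  have "sup_mean q u y = (\<integral>\<^sup>+\<omega>. (SUP n. grid_sup (\<lambda>t. q (y + X t \<omega>)) u n) \<partial>P 0)"
    unfolding sup_mean_def
  proof (intro nn_integral_cong SUP_grid_sup[symmetric] u)
    fix \<omega> t assume "\<omega> \<in> space (P 0)" "0 \<le> (t::real)"
    then show "((\<lambda>t. q (y + X t \<omega>)) \<longlongrightarrow> q (y + X t \<omega>)) (at_right t)"
      using tendsto_path_compose[OF q path_right_continuous, of \<omega> 0 t y] by (simp add: space_P)
  qed
  also have "\<dots> = (SUP n. grid_sup_mean q u n y)"
    unfolding grid_sup_mean_def
  proof (rule nn_integral_monotone_convergence_SUP)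
    show "incseq (\<lambda>n \<omega>. grid_sup (\<lambda>t. q (y + X t \<omega>)) u n)"
      using incseq_grid_sup by (auto simp: incseq_def le_fun_def)
    show "(\<lambda>\<omega>. grid_sup (\<lambda>t. q (y + X t \<omega>)) u n) \<in> borel_measurable (P 0)" for n
      by (intro borel_measurable_grid_sup) measurable
  qed
  finally show ?thesis ..
qed

text \<open>Both sides increase with \<open>n\<close>, so monotone convergence removes grid and
  truncation together.\<close>

lemma strong_markov_sup:
  assumes r: "0 \<le> r" and q: "continuous_on UNIV q" and u: "0 \<le> u" and \<tau>: "stopping_time F \<tau>"
  shows "(\<integral>\<^sup>+\<omega>. (if \<tau> \<omega> < \<top> then ennreal (exp (- r * enn2real (\<tau> \<omega>)))
        * (SUP t\<in>{0..u}. q (X (enn2real (\<tau> \<omega>) + t) \<omega>)) else 0) \<partial>P x)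
    = (\<integral>\<^sup>+\<omega>. (if \<tau> \<omega> < \<top> then ennreal (exp (- r * enn2real (\<tau> \<omega>)))
        * sup_mean q u (X (enn2real (\<tau> \<omega>)) \<omega>) else 0) \<partial>P x)" (is "?L = ?R")
proof -
  note [measurable] = borel_measurable_continuous_onI[OF q] measurable_stopping_time_P[OF \<tau>]
    borel_measurable_continuous_onI[OF continuous_grid_sup_mean[OF q u]]
  let ?e = "\<lambda>\<omega>. ennreal (exp (- r * enn2real (\<tau> \<omega>)))"
  let ?G = "\<lambda>n \<omega>. grid_sup (\<lambda>t. q (X (enn2real (\<tau> \<omega>) + t) \<omega>)) u n"
  let ?M = "\<lambda>n \<omega>. grid_sup_mean q u n (X (enn2real (\<tau> \<omega>)) \<omega>)"
  have X: "(\<lambda>\<omega>. X (enn2real (\<tau> \<omega>) + c) \<omega>) \<in> borel_measurable (P x)" if "0 \<le> c" for c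
    using that path_right_continuous
    by (intro measurable_at_stopping_time[OF \<tau>, where Y="\<lambda>s. X (s + c)"] measurable_X
        tendsto_at_right_shift) auto
  have [measurable]: "(\<lambda>\<omega>. X (enn2real (\<tau> \<omega>)) \<omega>) \<in> borel_measurable (P x)"
    using X[of 0] by simp
  have [measurable]: "(\<lambda>\<omega>. X (enn2real (\<tau> \<omega>) + real k * (u / 2 ^ n)) \<omega>) \<in> borel_measurable (P x)" for k n
    using u by (intro X) simp
  have "?L = (\<integral>\<^sup>+\<omega>. (SUP n. if \<tau> \<omega> < \<top> then ?e \<omega> * ?G n \<omega> else 0) \<partial>P x)"
  proof (intro nn_integral_cong)
    fix \<omega> assume \<omega>: "\<omega> \<in> space (P x)"
    have "(SUP n. ?G n \<omega>) = (SUP t\<in>{0..u}. q (X (enn2real (\<tau> \<omega>) + t) \<omega>))"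
      using \<omega> tendsto_path_compose[OF q path_right_continuous, of \<omega> "enn2real (\<tau> \<omega>)" _ 0]
      by (intro SUP_grid_sup u) (auto simp: space_P)
    then show "(if \<tau> \<omega> < \<top> then ?e \<omega> * (SUP t\<in>{0..u}. q (X (enn2real (\<tau> \<omega>) + t) \<omega>)) else 0)
        = (SUP n. if \<tau> \<omega> < \<top> then ?e \<omega> * ?G n \<omega> else 0)"
      by (simp add: SUP_mult_left_ennreal[symmetric])
  qed
  also have "\<dots> = (SUP n. \<integral>\<^sup>+\<omega>. (if \<tau> \<omega> < \<top> then ?e \<omega> * ?G n \<omega> else 0) \<partial>P x)"
  proof (rule nn_integral_monotone_convergence_SUP)
    show "incseq (\<lambda>n \<omega>. if \<tau> \<omega> < \<top> then ?e \<omega> * ?G n \<omega> else 0)"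
      using incseq_grid_sup by (auto simp: incseq_def le_fun_def intro!: mult_left_mono)
    show "(\<lambda>\<omega>. if \<tau> \<omega> < \<top> then ?e \<omega> * ?G n \<omega> else 0) \<in> borel_measurable (P x)" for n
    proof -
      have "?G n \<in> borel_measurable (P x)" by (intro borel_measurable_grid_sup) measurable
      then show ?thesis by measurable
    qed
  qed
  also have "\<dots> = (SUP n. \<integral>\<^sup>+\<omega>. (if \<tau> \<omega> < \<top> then ?e \<omega> * ?M n \<omega> else 0) \<partial>P x)"
    by (simp only: strong_markov_grid_sup[OF r q u \<tau>])
  also have "\<dots> = (\<integral>\<^sup>+\<omega>. (SUP n. if \<tau> \<omega> < \<top> then ?e \<omega> * ?M n \<omega> else 0) \<partial>P x)"
  proof (rule nn_integral_monotone_convergence_SUP[symmetric])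
    show "incseq (\<lambda>n \<omega>. if \<tau> \<omega> < \<top> then ?e \<omega> * ?M n \<omega> else 0)"
      using incseq_grid_sup unfolding grid_sup_mean_def
      by (auto simp: incseq_def le_fun_def intro!: mult_left_mono nn_integral_mono)
  qed measurable
  also have "\<dots> = ?R"
    by (intro nn_integral_cong) (simp add: SUP_mult_left_ennreal[symmetric] SUP_grid_sup_mean[OF q u])
  finally show ?thesis .
qed

text \<open>The strong Markov property at the constant time 0 without discounting identifies the
  mean under \<open>P y\<close> with that of the shifted path under \<open>P 0\<close>.\<close>

lemma nn_integral_sup_eq:
  assumes q: "continuous_on UNIV q" and u: "0 \<le> u"
  shows "(\<integral>\<^sup>+\<omega>. (SUP t\<in>{0..u}. q (X t \<omega>)) \<partial>P y) = sup_mean q u y"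
proof -
  interpret prob_space "P y" by (rule prob_space_P)
  have "(\<integral>\<^sup>+\<omega>. (SUP t\<in>{0..u}. q (X t \<omega>)) \<partial>P y) = (\<integral>\<^sup>+\<omega>. sup_mean q u (X 0 \<omega>) \<partial>P y)"
    using strong_markov_sup[OF order_refl q u stopping_time_const, of y 0] by simp
  also have "\<dots> = (\<integral>\<^sup>+\<omega>. sup_mean q u y \<partial>P y)"
    using starts_at[of y] by (intro nn_integral_cong_AE) auto
  finally show ?thesis by (simp add: emeasure_space_1)
qed

end

section \<open>The supremum up to an exponential time\<close>

lemma exponential_density_shift:
  "0 \<le> s \<Longrightarrow> 0 \<le> t \<Longrightarrow> exponential_density r (t + s) = exp (- r * t) * exponential_density r s"
  by (simp add: exponential_density_def exp_add[symmetric] algebra_simps)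

text \<open>The density vanishes at negative times, so the horizon may be replaced by its positive
  part; measurability of path suprema is stated for nonnegative horizons.\<close>

lemma exponential_density_max_0:
  "ennreal (exponential_density r s) * f (max 0 s) = ennreal (exponential_density r s) * f s"
  by (cases "0 \<le> s") (simp_all add: exponential_density_def)

text \<open>Memorylessness, followed by the substitution of \<open>t0 + s\<close> for the horizon: a
  discounted supremum over \<open>s\<close> time units after \<open>t0\<close> becomes an
  undiscounted one from \<open>t0\<close> up to the horizon.\<close>

lemma nn_integral_exponential_shift:
  fixes f :: "real \<Rightarrow> ennreal"
  assumes t0: "0 \<le> t0" and r: "0 < r"
    and G: "(\<lambda>s. SUP t\<in>{0..max 0 s}. f (t0 + t)) \<in> borel_measurable borel"
  shows "(\<integral>\<^sup>+s. ennreal (exponential_density r s) * (ennreal (exp (- r * t0)) * (SUP t\<in>{0..s}. f (t0 + t))) \<partial>lborel)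
    = (\<integral>\<^sup>+s. ennreal (exponential_density r s) * (SUP t\<in>{t0..s}. f t) \<partial>lborel)"
proof -
  \<comment> \<open>The right-hand integrand, in a form whose measurability follows from
    \<open>G\<close>. The indicator accounts for horizons before \<open>t0\<close>, where the
    supremum is over the empty set and equals 0.\<close>
  define F where "F s = ennreal (exponential_density r s) * indicator {t0..} s * (SUP t\<in>{0..max 0 (s - t0)}. f (t0 + t))" for s
  have "(\<lambda>s. SUP t\<in>{0..max 0 (s - t0)}. f (t0 + t)) \<in> borel_measurable borel"
    by (rule measurable_compose[OF _ G]) measurable
  then have F: "F \<in> borel_measurable borel" unfolding F_def by measurable
  have SUP: "(SUP t\<in>{0..s - t0}. f (t0 + t)) = (SUP t\<in>{t0..s}. f t)" for s
  proof -
    have "{t0..s} = (\<lambda>t. t0 + t) ` {0..s - t0}" by (simp add: image_add_atLeastAtMost)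
    then show ?thesis by (simp only: image_comp o_def)
  qed
  have F_eq: "F s = ennreal (exponential_density r s) * (SUP t\<in>{t0..s}. f t)" for s
  proof (cases "t0 \<le> s")
    case True
    then show ?thesis by (simp add: F_def SUP max_def)
  next
    case False
    then show ?thesis by (simp add: F_def bot_ennreal)
  qed
  have shift: "F (t0 + s) = ennreal (exponential_density r s) * (ennreal (exp (- r * t0)) * (SUP t\<in>{0..s}. f (t0 + t)))" for s
  proof (cases "0 \<le> s")
    case True
    then have "ennreal (exponential_density r (t0 + s)) = ennreal (exponential_density r s) * ennreal (exp (- r * t0))"
      using t0 r by (simp only: exponential_density_shift)
        (simp add: ennreal_mult[symmetric] exponential_density_nonneg mult.commute)
    with True show ?thesis by (simp add: F_def max_def mult.assoc)
  next
    case False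
    then show ?thesis by (simp add: F_def exponential_density_def)
  qed
  have "integral\<^sup>N lborel F = (\<integral>\<^sup>+s. F (t0 + s) \<partial>lborel)"
    using nn_integral_real_affine[OF F, of 1 t0] by simp
  moreover have "integral\<^sup>N lborel F = (\<integral>\<^sup>+s. ennreal (exponential_density r s) * (SUP t\<in>{t0..s}. f t) \<partial>lborel)"
    by (intro nn_integral_cong F_eq)
  ultimately show ?thesis by (simp only: shift)
qed

lemma SUP_le_SUP_from:
  fixes f :: "real \<Rightarrow> ennreal"
  assumes "0 \<le> t0"
  shows "(SUP t\<in>{t0..s}. f t) \<le> (SUP t\<in>{0..s}. f t)"
  using assms by (intro SUP_subset_mono) auto

text \<open>The discarded times contribute 0, the least value. For \<open>s < t0\<close> the left
  supremum is empty and agrees with the right one, which is then 0.\<close>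

lemma SUP_eq_SUP_from:
  fixes f :: "real \<Rightarrow> ennreal"
  assumes "0 \<le> t0" and z: "\<And>t. 0 \<le> t \<Longrightarrow> t < t0 \<Longrightarrow> f t = 0"
  shows "(SUP t\<in>{t0..s}. f t) = (SUP t\<in>{0..s}. f t)"
proof (rule antisym[OF SUP_le_SUP_from[OF assms(1)]], rule SUP_least)
  fix t assume "t \<in> {0..s}"
  then show "f t \<le> (SUP t\<in>{t0..s}. f t)"
    using z[of t] by (cases "t < t0") (auto intro!: SUP_upper)
qed

context regular_levy_process
begin

lemma borel_measurable_sup_mean:
  assumes q: "continuous_on UNIV q"
  shows "(\<lambda>(s, y). sup_mean q (max 0 s) y) \<in> borel_measurable (borel \<Otimes>\<^sub>M borel)"
proof -
  interpret prob_space "P 0" by (rule prob_space_P)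
  have "(\<lambda>z::(real \<times> real) \<times> 'a. SUP t\<in>{0..max 0 (fst (fst z))}. q (snd (fst z) + X (0 + t) (snd z)))
      \<in> borel_measurable ((borel \<Otimes>\<^sub>M borel) \<Otimes>\<^sub>M P 0)"
    by (intro borel_measurable_path_sup[where N="P 0"] q measurable_X path_right_continuous)
      (auto simp: space_P)
  then have "(\<lambda>((s, y), \<omega>). SUP t\<in>{0..max 0 s}. q (y + X t \<omega>)) \<in> borel_measurable ((borel \<Otimes>\<^sub>M borel) \<Otimes>\<^sub>M P 0)"
    by (simp add: case_prod_beta')
  then show ?thesis unfolding sup_mean_def
    by (auto intro!: borel_measurable_nn_integral simp: case_prod_beta')
qed

text \<open>The function \<open>v\<close> of the overview, with the density in place of
  \<open>e\<close>.\<close>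

definition exp_sup_mean :: "real \<Rightarrow> (real \<Rightarrow> ennreal) \<Rightarrow> real \<Rightarrow> ennreal" where
  "exp_sup_mean r q y = (\<integral>\<^sup>+s. ennreal (exponential_density r s) * sup_mean q s y \<partial>lborel)"

lemma exp_sup_mean_eq:
  "exp_sup_mean r q y = (\<integral>\<^sup>+s. ennreal (exponential_density r s) * sup_mean q (max 0 s) y \<partial>lborel)"
  unfolding exp_sup_mean_def
  by (intro nn_integral_cong exponential_density_max_0[of r _ "\<lambda>s. sup_mean q s y", symmetric])

lemma borel_measurable_exp_sup_mean:
  assumes q: "continuous_on UNIV q"
  shows "exp_sup_mean r q \<in> borel_measurable borel"
proof -
  note [measurable] = borel_measurable_sup_mean[OF q]
  have "(\<lambda>y. \<integral>\<^sup>+s. ennreal (exponential_density r s) * sup_mean q (max 0 s) y \<partial>lborel) \<in> borel_measurable borel"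
    by measurable
  then show ?thesis by (simp add: exp_sup_mean_eq[abs_def])
qed

lemma borel_measurable_path_sup_prod:
  fixes q :: "real \<Rightarrow> ennreal"
  assumes q: "continuous_on UNIV q" and N: "space N = \<Omega>" "\<And>t. 0 \<le> t \<Longrightarrow> X t \<in> borel_measurable N"
  shows "(\<lambda>(\<omega>, s). SUP t\<in>{0..max 0 s}. q (X t \<omega>)) \<in> borel_measurable (N \<Otimes>\<^sub>M borel)"
proof -
  have "(\<lambda>z. SUP t\<in>{0..max 0 (snd z)}. q (0 + X (0 + t) (fst z))) \<in> borel_measurable (N \<Otimes>\<^sub>M borel)"
    by (rule borel_measurable_path_sup[where N=N and S="\<lambda>_. 0" and c="\<lambda>_. 0"])
      (auto simp: N q intro: path_right_continuous)
  then show ?thesis by (simp add: case_prod_beta')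
qed

text \<open>With the average over horizons inside, the values with and without stopping can be
  compared path by path.\<close>

lemma nn_integral_exp_path_sup:
  assumes q: "continuous_on UNIV q"
  shows "(\<integral>\<^sup>+\<omega>. \<integral>\<^sup>+s. ennreal (exponential_density r s) * (SUP t\<in>{0..s}. q (X t \<omega>)) \<partial>lborel \<partial>P y)
    = exp_sup_mean r q y"
proof -
  interpret y: prob_space "P y" by (rule prob_space_P)
  interpret pair_sigma_finite "P y" lborel ..
  note [measurable] = borel_measurable_path_sup_prod[OF q space_P measurable_X]
  have "(\<integral>\<^sup>+\<omega>. \<integral>\<^sup>+s. ennreal (exponential_density r s) * (SUP t\<in>{0..s}. q (X t \<omega>)) \<partial>lborel \<partial>P y)
      = (\<integral>\<^sup>+\<omega>. \<integral>\<^sup>+s. ennreal (exponential_density r s) * (SUP t\<in>{0..max 0 s}. q (X t \<omega>)) \<partial>lborel \<partial>P y)"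
    by (subst exponential_density_max_0) simp
  also have "\<dots> = (\<integral>\<^sup>+s. \<integral>\<^sup>+\<omega>. ennreal (exponential_density r s) * (SUP t\<in>{0..max 0 s}. q (X t \<omega>)) \<partial>P y \<partial>lborel)"
    by (rule Fubini'[symmetric]) measurable
  also have "\<dots> = (\<integral>\<^sup>+s. ennreal (exponential_density r s) * sup_mean q (max 0 s) y \<partial>lborel)"
  proof (rule nn_integral_cong)
    fix s
    have "(\<lambda>\<omega>. SUP t\<in>{0..max 0 s}. q (X t \<omega>)) \<in> borel_measurable (P y)" by measurable
    then show "(\<integral>\<^sup>+\<omega>. ennreal (exponential_density r s) * (SUP t\<in>{0..max 0 s}. q (X t \<omega>)) \<partial>P y)
        = ennreal (exponential_density r s) * sup_mean q (max 0 s) y"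
      by (simp add: nn_integral_cmult nn_integral_sup_eq[OF q])
  qed
  finally show ?thesis by (simp add: exp_sup_mean_eq)
qed

lemma independent_exponential_time_nonneg:
  assumes e: "independent_exponential_time P X r e"
  shows "AE \<omega> in P y. 0 \<le> e \<omega>"
proof -
  have d: "distributed (P y) lborel e (\<lambda>x. ennreal (exponential_density r x))"
    using e by (auto simp: independent_exponential_time_def)
  then have [measurable]: "e \<in> borel_measurable (P y)"
    by (auto simp: distributed_def)
  have "(\<integral>\<^sup>+\<omega>. indicator {..<0} (e \<omega>) \<partial>P y)
      = (\<integral>\<^sup>+s. ennreal (exponential_density r s) * indicator {..<0} s \<partial>lborel)"
    by (rule distributed_nn_integral[OF d, symmetric]) simp
  also have "\<dots> = (\<integral>\<^sup>+s. 0 \<partial>(lborel :: real measure))"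
    by (intro nn_integral_cong) (auto simp: exponential_density_def indicator_def)
  finally have "AE \<omega> in P y. indicator {..<0} (e \<omega>) = (0::ennreal)"
    by (subst nn_integral_0_iff_AE[symmetric]) auto
  then show ?thesis by eventually_elim (auto simp: indicator_def split: if_splits)
qed

text \<open>Independence of \<open>e\<close> concerns the sigma-algebra \<open>N\<close> generated
  by the path. The supremum is therefore shown to be measurable with respect to \<open>N\<close>,
  and the product formula is applied to the identity map into \<open>N\<close>.\<close>

lemma nn_integral_exp_time_sup:
  assumes q: "continuous_on UNIV q" and e: "independent_exponential_time P X r e"
  shows "(\<integral>\<^sup>+\<omega>. (SUP t\<in>{0..e \<omega>}. q (X t \<omega>)) \<partial>P y) = exp_sup_mean r q y"
proof -
  interpret prob_space "P y" by (rule prob_space_P)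
  define N where "N = vimage_algebra \<Omega> (\<lambda>\<omega>. \<lambda>t\<in>{0..}. X t \<omega>) (Pi\<^sub>M {0..} (\<lambda>_. borel :: real measure))"
  have d: "distributed (P y) lborel e (\<lambda>x. ennreal (exponential_density r x))"
    and ind: "indep_set (sets N) (sets (vimage_algebra \<Omega> e borel))"
    using e by (auto simp: independent_exponential_time_def N_def space_P)
  from d have [measurable]: "e \<in> borel_measurable (P y)"
    by (auto simp: distributed_def)
  have space_N: "space N = \<Omega>" by (simp add: N_def)
  have X_N: "X t \<in> borel_measurable N" if "0 \<le> t" for t
  proof -
    have paths: "(\<lambda>\<omega>. \<lambda>t\<in>{0..}. X t \<omega>) \<in> measurable N (Pi\<^sub>M {0..} (\<lambda>_. borel))"
      unfolding N_def by (rule measurable_vimage_algebra1) (auto simp: space_PiM)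
    have "(\<lambda>f. f t) \<in> borel_measurable (Pi\<^sub>M {0..} (\<lambda>_. borel :: real measure))"
      using that by (intro measurable_component_singleton) simp
    from measurable_compose[OF paths this] show ?thesis using that by simp
  qed
  note [measurable] = borel_measurable_path_sup_prod[OF q space_N X_N]
  have "(\<integral>\<^sup>+\<omega>. (SUP t\<in>{0..e \<omega>}. q (X t \<omega>)) \<partial>P y) = (\<integral>\<^sup>+\<omega>. (SUP t\<in>{0..max 0 (e \<omega>)}. q (X t \<omega>)) \<partial>P y)"
    using independent_exponential_time_nonneg[OF e, of y] by (intro nn_integral_cong_AE) (auto simp: max_def)
  also have "\<dots> = (\<integral>\<^sup>+\<omega>. \<integral>\<^sup>+\<omega>'. (SUP t\<in>{0..max 0 (e \<omega>')}. q (X t \<omega>)) \<partial>P y \<partial>P y)"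
  proof (rule nn_integral_indep[OF ind, where f="\<lambda>(\<omega>, s). SUP t\<in>{0..max 0 s}. q (X t \<omega>)" and X="\<lambda>\<omega>. \<omega>" and S=N
        and Y=e and T=borel, unfolded prod.case])
    show "(\<lambda>\<omega>. \<omega>) \<in> measurable (P y) N"
      using indep_setD_ev1[OF ind] by (auto simp: measurable_def space_P space_N dest: sets.sets_into_space)
    show "(\<lambda>\<omega>. \<omega>) -` E \<inter> space (P y) \<in> sets N" if "E \<in> sets N" for E
      using that sets.sets_into_space[of E N] by (simp add: space_P space_N Int_absorb2)
    show "e -` E \<inter> space (P y) \<in> sets (vimage_algebra \<Omega> e borel)" if "E \<in> sets borel" for E
      unfolding space_P using that by (rule in_vimage_algebra)
    show "e \<in> borel_measurable (P y)" by measurable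
    show "(\<lambda>(\<omega>, s). SUP t\<in>{0..max 0 s}. q (X t \<omega>)) \<in> borel_measurable (N \<Otimes>\<^sub>M borel)"
      by measurable
  qed
  also have "\<dots> = (\<integral>\<^sup>+\<omega>. \<integral>\<^sup>+s. ennreal (exponential_density r s) * (SUP t\<in>{0..max 0 s}. q (X t \<omega>)) \<partial>lborel \<partial>P y)"
  proof (rule nn_integral_cong)
    fix \<omega> assume "\<omega> \<in> space (P y)"
    then have [measurable]: "\<omega> \<in> space N" by (simp add: space_P space_N)
    have "(\<lambda>s. SUP t\<in>{0..max 0 s}. q (X t \<omega>)) \<in> borel_measurable lborel" by measurable
    then show "(\<integral>\<^sup>+\<omega>'. (SUP t\<in>{0..max 0 (e \<omega>')}. q (X t \<omega>)) \<partial>P y)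
        = (\<integral>\<^sup>+s. ennreal (exponential_density r s) * (SUP t\<in>{0..max 0 s}. q (X t \<omega>)) \<partial>lborel)"
      by (rule distributed_nn_integral[OF d, symmetric])
  qed
  also have "\<dots> = exp_sup_mean r q y"
    by (subst exponential_density_max_0) (rule nn_integral_exp_path_sup[OF q])
  finally show ?thesis .
qed

text \<open>With the horizon outermost it is fixed, and \<open>strong_markov_sup\<close> applies;
  with the path outermost the memoryless shift applies. Hence Fubini's theorem is used once in each
  direction.\<close>

lemma exp_sup_mean_at_stopping_time:
  assumes r: "0 < r" and q: "continuous_on UNIV q" and \<tau>: "stopping_time F \<tau>"
  shows "(\<integral>\<^sup>+\<omega>. (if \<tau> \<omega> < \<top> then ennreal (exp (- r * enn2real (\<tau> \<omega>)))
        * exp_sup_mean r q (X (enn2real (\<tau> \<omega>)) \<omega>) else 0) \<partial>P x)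
    = (\<integral>\<^sup>+\<omega>. (if \<tau> \<omega> < \<top> then \<integral>\<^sup>+s. ennreal (exponential_density r s)
        * (SUP t\<in>{enn2real (\<tau> \<omega>)..s}. q (X t \<omega>)) \<partial>lborel else 0) \<partial>P x)"
proof -
  interpret x: prob_space "P x" by (rule prob_space_P)
  interpret pair_sigma_finite "P x" lborel ..
  let ?t = "\<lambda>\<omega>. enn2real (\<tau> \<omega>)"
  let ?e = "\<lambda>\<omega>. ennreal (exp (- r * ?t \<omega>))"
  let ?d = "\<lambda>s. ennreal (exponential_density r s)"
  note [measurable] = measurable_stopping_time_P[OF \<tau>] borel_measurable_sup_mean[OF q]
  have [measurable]: "(\<lambda>\<omega>. X (?t \<omega>) \<omega>) \<in> borel_measurable (P x)"
    by (rule measurable_at_stopping_time[OF \<tau>]) (rule measurable_X path_right_continuous; assumption)+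
  have "(\<lambda>z. SUP t\<in>{0..max 0 (snd z)}. q (0 + X (?t (fst z) + t) (fst z))) \<in> borel_measurable (P x \<Otimes>\<^sub>M borel)"
    by (intro borel_measurable_path_sup[where N="P x"] q measurable_X path_right_continuous) (auto simp: space_P)
  then have [measurable]: "(\<lambda>(\<omega>, s). SUP t\<in>{0..max 0 s}. q (X (?t \<omega> + t) \<omega>)) \<in> borel_measurable (P x \<Otimes>\<^sub>M borel)"
    by (simp add: case_prod_beta')
  have "(\<integral>\<^sup>+\<omega>. (if \<tau> \<omega> < \<top> then ?e \<omega> * exp_sup_mean r q (X (?t \<omega>) \<omega>) else 0) \<partial>P x)
      = (\<integral>\<^sup>+\<omega>. \<integral>\<^sup>+s. ?d s * (if \<tau> \<omega> < \<top> then ?e \<omega> * sup_mean q (max 0 s) (X (?t \<omega>) \<omega>) else 0) \<partial>lborel \<partial>P x)"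
  proof (rule nn_integral_cong)
    fix \<omega>
    have "(\<integral>\<^sup>+s. ?e \<omega> * (?d s * sup_mean q (max 0 s) (X (?t \<omega>) \<omega>)) \<partial>lborel)
        = ?e \<omega> * (\<integral>\<^sup>+s. ?d s * sup_mean q (max 0 s) (X (?t \<omega>) \<omega>) \<partial>lborel)"
      by (rule nn_integral_cmult) measurable
    then show "(if \<tau> \<omega> < \<top> then ?e \<omega> * exp_sup_mean r q (X (?t \<omega>) \<omega>) else 0)
        = (\<integral>\<^sup>+s. ?d s * (if \<tau> \<omega> < \<top> then ?e \<omega> * sup_mean q (max 0 s) (X (?t \<omega>) \<omega>) else 0) \<partial>lborel)"
      by (simp add: exp_sup_mean_eq ac_simps)
  qed
  also have "\<dots> = (\<integral>\<^sup>+s. \<integral>\<^sup>+\<omega>. ?d s * (if \<tau> \<omega> < \<top> then ?e \<omega> * sup_mean q (max 0 s) (X (?t \<omega>) \<omega>) else 0) \<partial>P x \<partial>lborel)"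
    by (rule Fubini'[symmetric]) measurable
  also have "\<dots> = (\<integral>\<^sup>+s. \<integral>\<^sup>+\<omega>. ?d s * (if \<tau> \<omega> < \<top> then ?e \<omega> * (SUP t\<in>{0..max 0 s}. q (X (?t \<omega> + t) \<omega>)) else 0) \<partial>P x \<partial>lborel)"
  proof (rule nn_integral_cong)
    fix s
    have "(\<integral>\<^sup>+\<omega>. ?d s * (if \<tau> \<omega> < \<top> then ?e \<omega> * sup_mean q (max 0 s) (X (?t \<omega>) \<omega>) else 0) \<partial>P x)
        = ?d s * (\<integral>\<^sup>+\<omega>. (if \<tau> \<omega> < \<top> then ?e \<omega> * sup_mean q (max 0 s) (X (?t \<omega>) \<omega>) else 0) \<partial>P x)"
      by (rule nn_integral_cmult) measurable
    also have "\<dots> = ?d s * (\<integral>\<^sup>+\<omega>. (if \<tau> \<omega> < \<top> then ?e \<omega> * (SUP t\<in>{0..max 0 s}. q (X (?t \<omega> + t) \<omega>)) else 0) \<partial>P x)"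
      using r by (subst strong_markov_sup[OF _ q _ \<tau>]) auto
    also have "\<dots> = (\<integral>\<^sup>+\<omega>. ?d s * (if \<tau> \<omega> < \<top> then ?e \<omega> * (SUP t\<in>{0..max 0 s}. q (X (?t \<omega> + t) \<omega>)) else 0) \<partial>P x)"
      by (rule nn_integral_cmult[symmetric]) measurable
    finally show "(\<integral>\<^sup>+\<omega>. ?d s * (if \<tau> \<omega> < \<top> then ?e \<omega> * sup_mean q (max 0 s) (X (?t \<omega>) \<omega>) else 0) \<partial>P x)
        = (\<integral>\<^sup>+\<omega>. ?d s * (if \<tau> \<omega> < \<top> then ?e \<omega> * (SUP t\<in>{0..max 0 s}. q (X (?t \<omega> + t) \<omega>)) else 0) \<partial>P x)" .
  qed
  also have "\<dots> = (\<integral>\<^sup>+\<omega>. \<integral>\<^sup>+s. ?d s * (if \<tau> \<omega> < \<top> then ?e \<omega> * (SUP t\<in>{0..max 0 s}. q (X (?t \<omega> + t) \<omega>)) else 0) \<partial>lborel \<partial>P x)"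
    by (rule Fubini') measurable
  also have "\<dots> = (\<integral>\<^sup>+\<omega>. (if \<tau> \<omega> < \<top> then \<integral>\<^sup>+s. ?d s * (SUP t\<in>{?t \<omega>..s}. q (X t \<omega>)) \<partial>lborel else 0) \<partial>P x)"
  proof (rule nn_integral_cong)
    fix \<omega> assume [measurable]: "\<omega> \<in> space (P x)"
    have "(\<lambda>s. SUP t\<in>{0..max 0 s}. q (X (?t \<omega> + t) \<omega>)) \<in> borel_measurable borel" by measurable
    then have "(\<integral>\<^sup>+s. ?d s * (?e \<omega> * (SUP t\<in>{0..s}. q (X (?t \<omega> + t) \<omega>))) \<partial>lborel)
        = (\<integral>\<^sup>+s. ?d s * (SUP t\<in>{?t \<omega>..s}. q (X t \<omega>)) \<partial>lborel)"
      by (intro nn_integral_exponential_shift[where f="\<lambda>t. q (X t \<omega>)"] r) auto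
    then show "(\<integral>\<^sup>+s. ?d s * (if \<tau> \<omega> < \<top> then ?e \<omega> * (SUP t\<in>{0..max 0 s}. q (X (?t \<omega> + t) \<omega>)) else 0) \<partial>lborel)
        = (if \<tau> \<omega> < \<top> then \<integral>\<^sup>+s. ?d s * (SUP t\<in>{?t \<omega>..s}. q (X t \<omega>)) \<partial>lborel else 0)"
      using exponential_density_max_0[of r _ "\<lambda>s. ?e \<omega> * (SUP t\<in>{0..s}. q (X (?t \<omega> + t) \<omega>))"] by simp
  qed
  finally show ?thesis .
qed

lemma exp_sup_mean_stopped_le:
  assumes "0 < r" "continuous_on UNIV q" "stopping_time F \<tau>"
  shows "(\<integral>\<^sup>+\<omega>. (if \<tau> \<omega> < \<top> then ennreal (exp (- r * enn2real (\<tau> \<omega>)))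
        * exp_sup_mean r q (X (enn2real (\<tau> \<omega>)) \<omega>) else 0) \<partial>P x) \<le> exp_sup_mean r q x"
  unfolding exp_sup_mean_at_stopping_time[OF assms]
  by (subst nn_integral_exp_path_sup[OF assms(2), symmetric], intro nn_integral_mono)
    (auto intro!: nn_integral_mono mult_left_mono SUP_le_SUP_from)

lemma exp_sup_mean_stopped_eq:
  assumes "0 < r" "continuous_on UNIV q" "stopping_time F \<tau>"
    and zero: "\<And>\<omega> t. \<omega> \<in> \<Omega> \<Longrightarrow> 0 \<le> t \<Longrightarrow> ennreal t < \<tau> \<omega> \<Longrightarrow> q (X t \<omega>) = 0"
  shows "(\<integral>\<^sup>+\<omega>. (if \<tau> \<omega> < \<top> then ennreal (exp (- r * enn2real (\<tau> \<omega>)))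
        * exp_sup_mean r q (X (enn2real (\<tau> \<omega>)) \<omega>) else 0) \<partial>P x) = exp_sup_mean r q x"
  unfolding exp_sup_mean_at_stopping_time[OF assms(1-3)]
proof (subst nn_integral_exp_path_sup[OF assms(2), symmetric], rule nn_integral_cong)
  fix \<omega> assume "\<omega> \<in> space (P x)"
  then have \<omega>: "\<omega> \<in> \<Omega>" by (simp add: space_P)
  show "(if \<tau> \<omega> < \<top> then \<integral>\<^sup>+s. ennreal (exponential_density r s)
        * (SUP t\<in>{enn2real (\<tau> \<omega>)..s}. q (X t \<omega>)) \<partial>lborel else 0)
      = (\<integral>\<^sup>+s. ennreal (exponential_density r s) * (SUP t\<in>{0..s}. q (X t \<omega>)) \<partial>lborel)"
  proof (cases "\<tau> \<omega>")
    case (real t0)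
    then have "(SUP t\<in>{t0..s}. q (X t \<omega>)) = (SUP t\<in>{0..s}. q (X t \<omega>))" for s
      by (intro SUP_eq_SUP_from zero \<omega>) (auto simp: ennreal_less_iff)
    with real show ?thesis by simp
  next
    case top
    \<comment> \<open>A path that never stops keeps \<open>q\<close> at 0 forever, which matches the
      value 0 assigned to an infinite stopping time.\<close>
    have "(SUP t\<in>{0..s}. q (X t \<omega>)) \<le> 0" for s
      by (rule SUP_least) (use top zero[OF \<omega>] in simp)
    with top show ?thesis by simp
  qed
qed

end

section \<open>Exit times\<close>

text \<open>A closed exhaustion of an open set. The pointwise form also gives the right answer for
  \<open>A = UNIV\<close>, where there is no complement to measure the distance from.\<close>

definition shrunk :: "real set \<Rightarrow> nat \<Rightarrow> real set" where
  "shrunk A n = {x. \<forall>y. y \<notin> A \<longrightarrow> 1 / real (Suc n) \<le> dist x y}"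

lemma closed_shrunk: "closed (shrunk A n)"
  unfolding shrunk_def by (intro closed_Collect_all closed_Collect_imp closed_Collect_le) (auto intro!: continuous_intros)

lemma shrunk_subset: "shrunk A n \<subseteq> A"
  unfolding shrunk_def using dist_self by (force simp: field_simps)

lemma shrunk_mono: "m \<le> n \<Longrightarrow> shrunk A m \<subseteq> shrunk A n"
  unfolding shrunk_def by (auto intro: order_trans[rotated] simp: frac_le)

text \<open>The interior is needed because \<open>at_exit_time\<close> places the path outside the
  interior only.\<close>

lemma in_interior_shrunk:
  assumes "open A" "x \<in> A"
  obtains m where "x \<in> interior (shrunk A m)"
proof -
  from assms obtain e where e: "0 < e" "ball x e \<subseteq> A" by (auto simp: open_contains_ball)
  obtain m where m: "1 / real (Suc m) < e / 2" using nat_approx_posE[of "e / 2"] e by auto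
  have "ball x (e / 2) \<subseteq> shrunk A m"
  proof
    fix z assume z: "z \<in> ball x (e / 2)"
    have "1 / real (Suc m) \<le> dist z y" if "y \<notin> A" for y
    proof -
      have "y \<notin> ball x e" using e that by auto
      then have "e \<le> dist x y" by simp
      also have "\<dots> \<le> dist x z + dist z y" by (rule dist_triangle)
      finally show ?thesis using z m by simp
    qed
    then show "z \<in> shrunk A m" by (simp add: shrunk_def)
  qed
  then have "x \<in> interior (shrunk A m)" using e by (intro interiorI[of "ball x (e / 2)"]) auto
  then show thesis by (rule that)
qed

lemma exit_time_mono: "A \<subseteq> B \<Longrightarrow> exit_time X A \<omega> \<le> exit_time X B \<omega>"
  unfolding exit_time_def by (rule Inf_superset_mono) auto

lemma exit_time_le: "0 \<le> t \<Longrightarrow> X t \<omega> \<notin> A \<Longrightarrow> exit_time X A \<omega> \<le> ennreal t"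
  unfolding exit_time_def by (rule Inf_lower) auto

lemma before_exit_time: "0 \<le> t \<Longrightarrow> ennreal t < exit_time X A \<omega> \<Longrightarrow> X t \<omega> \<in> A"
  using exit_time_le[of t X \<omega> A] by (auto simp: not_less[symmetric])

text \<open>From an interior point a right-continuous path stays in \<open>A\<close> for some time
  longer, which would push the infimum beyond \<open>t0\<close>. A boundary point cannot be
  excluded, since the infimum need not be attained.\<close>

lemma at_exit_time:
  assumes rc: "((\<lambda>t. X t \<omega>) \<longlongrightarrow> X t0 \<omega>) (at_right t0)" and t0: "0 \<le> t0"
    and exit: "exit_time X A \<omega> = ennreal t0"
  shows "X t0 \<omega> \<notin> interior A"
proof
  assume "X t0 \<omega> \<in> interior A"
  from topological_tendstoD[OF rc open_interior this] obtain b where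
    b: "t0 < b" "\<And>t. t0 < t \<Longrightarrow> t < b \<Longrightarrow> X t \<omega> \<in> A"
    using interior_subset by (auto simp: eventually_at_right_field)
  have "ennreal b \<le> exit_time X A \<omega>"
    unfolding exit_time_def
  proof (rule Inf_greatest, clarify)
    fix t assume t: "0 \<le> t" "X t \<omega> \<notin> A"
    have "\<not> t < t0"
      using before_exit_time[of t X A \<omega>] t t0 exit by (auto simp: ennreal_less_iff)
    moreover have "t \<noteq> t0" using \<open>X t0 \<omega> \<in> interior A\<close> interior_subset t by blast
    ultimately show "ennreal b \<le> ennreal t"
      using b(2)[of t] t by (intro ennreal_leI) force
  qed
  with exit b(1) t0 show False by (simp add: ennreal_le_iff)
qed

context stochastic_basis
begin

text \<open>The event \<open>T \<le> t\<close> is an intersection of events \<open>T < s\<close>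
  with \<open>s\<close> decreasing to \<open>t\<close>. It is known at every time after
  \<open>t\<close>, and right-continuity of the filtration brings it back to
  \<open>t\<close>.\<close>

lemma stopping_time_lessI:
  assumes T: "\<And>t. {\<omega>\<in>\<Omega>. T \<omega> < t} \<in> sets (F t)"
  shows "stopping_time F T"
proof
  fix t :: ennreal
  show "Measurable.pred (F t) (\<lambda>\<omega>. T \<omega> \<le> t)"
  proof (cases "t < \<top>")
    case True
    have "{\<omega>\<in>\<Omega>. T \<omega> \<le> t} \<in> sets (F u)" if u: "t < u" for u
    proof -
      \<comment> \<open>Capping at \<open>u\<close> keeps all these events in
        \<open>F u\<close>.\<close>
      let ?s = "\<lambda>n. min u (t + ennreal (1 / real (Suc n)))"
      have s: "t < ?s n" for n
        using u True by (cases t) (auto simp: ennreal_plus[symmetric] ennreal_less_iff simp del: ennreal_plus)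
      have "T \<omega> \<le> t \<longleftrightarrow> (\<forall>n. T \<omega> < ?s n)" for \<omega>
      proof
        assume "T \<omega> \<le> t"
        then show "\<forall>n. T \<omega> < ?s n" using s by (auto intro: order.strict_trans1)
      next
        assume *: "\<forall>n. T \<omega> < ?s n"
        show "T \<omega> \<le> t"
        proof (rule ennreal_le_epsilon)
          fix e :: real assume "0 < e"
          then obtain n where "1 / real (Suc n) < e" using nat_approx_posE by blast
          then have "t + ennreal (1 / real (Suc n)) \<le> t + ennreal e"
            by (intro add_left_mono ennreal_leI) simp
          moreover have "T \<omega> < t + ennreal (1 / real (Suc n))" using * by simp
          ultimately show "T \<omega> \<le> t + ennreal e" by (rule order.trans[OF less_imp_le, rotated])
        qed
      qed
      then have "{\<omega>\<in>\<Omega>. T \<omega> \<le> t} = (\<Inter>n. {\<omega>\<in>\<Omega>. T \<omega> < ?s n})" by auto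
      moreover have "{\<omega>\<in>\<Omega>. T \<omega> < ?s n} \<in> sets (F u)" for n
        using T[of "?s n"] sets_F_mono[of "?s n" u] by auto
      ultimately show ?thesis by (auto intro!: sets.countable_INT)
    qed
    then show ?thesis
      using right_continuous[OF True] by (simp add: pred_def space_F)
  next
    case False
    then have "t = \<top>" by (simp add: less_top[symmetric])
    then show ?thesis by simp
  qed
qed

lemma negligible_sets_F:
  assumes "\<And>x. AE \<omega> in P x. \<omega> \<notin> N" "N \<subseteq> \<Omega>"
  shows "N \<in> sets (F t)"
proof -
  have "\<exists>B\<in>null_sets (P x). N \<subseteq> B" for x
  proof -
    from AE_E[OF assms(1)[of x]] obtain B where
      "{\<omega> \<in> space (P x). \<not> \<omega> \<notin> N} \<subseteq> B" "emeasure (P x) B = 0" "B \<in> sets (P x)" .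
    with assms(2) show ?thesis by (intro bexI[of _ B]) (auto simp: space_P null_sets_def)
  qed
  then have "N \<in> sets (F 0)" by (rule complete)
  then show ?thesis using sets_F_mono[of 0 t] by auto
qed

text \<open>The two times differ on a set that is negligible under every \<open>P x\<close>, so each
  of its subsets already belongs to \<open>F 0\<close>.\<close>

lemma stopping_time_AE_cong:
  assumes S: "stopping_time F S" and eq: "\<And>x. AE \<omega> in P x. S \<omega> = T \<omega>"
  shows "stopping_time F T"
proof
  fix t
  have neg: "B \<in> sets (F t)" if "B \<subseteq> {\<omega>\<in>\<Omega>. S \<omega> \<noteq> T \<omega>}" for B
  proof (rule negligible_sets_F)
    show "AE \<omega> in P x. \<omega> \<notin> B" for x using eq[of x] that by (auto elim: AE_mp)
  qed (use that in auto)
  have "{\<omega>\<in>\<Omega>. T \<omega> \<le> t} = ({\<omega>\<in>\<Omega>. S \<omega> \<le> t} - {\<omega>\<in>\<Omega>. S \<omega> \<noteq> T \<omega>}) \<union> {\<omega>\<in>\<Omega>. T \<omega> \<le> t \<and> S \<omega> \<noteq> T \<omega>}"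
    by auto
  moreover have "{\<omega>\<in>\<Omega>. S \<omega> \<le> t} \<in> sets (F t)"
    using stopping_timeD[OF S, of t] by (simp add: pred_def space_F)
  moreover have "{\<omega>\<in>\<Omega>. S \<omega> \<noteq> T \<omega>} \<in> sets (F t)" "{\<omega>\<in>\<Omega>. T \<omega> \<le> t \<and> S \<omega> \<noteq> T \<omega>} \<in> sets (F t)"
    by (auto intro!: neg)
  ultimately show "Measurable.pred (F t) (\<lambda>\<omega>. T \<omega> \<le> t)"
    by (auto simp: pred_def space_F)
qed

end

section \<open>Exit times as stopping times, and quasi-left-continuity\<close>

context regular_levy_process
begin

text \<open>The complement is open, so a right-continuous path that is outside \<open>A\<close> at
  some time is still outside at slightly later rational times. Countably many times decide whether
  the exit comes before \<open>t\<close>.\<close>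

lemma stopping_time_exit_closed:
  assumes A: "closed A"
  shows "stopping_time F (exit_time X A)"
proof (rule stopping_time_lessI)
  fix t :: ennreal
  let ?Q = "{q \<in> \<rat>. 0 \<le> q \<and> ennreal q < t}"
  have "exit_time X A \<omega> < t \<longleftrightarrow> (\<exists>q\<in>?Q. X q \<omega> \<notin> A)" if \<omega>: "\<omega> \<in> \<Omega>" for \<omega>
  proof
    assume "exit_time X A \<omega> < t"
    then obtain s where s: "0 \<le> s" "X s \<omega> \<notin> A" "ennreal s < t"
      unfolding exit_time_def Inf_less_iff by auto
    \<comment> \<open>The bound \<open>t\<close> may be infinite; choosing a rational requires a
      real one.\<close>
    obtain t' where t': "s < t'" "ennreal t' \<le> t"
    proof (cases t)
      case (real u)
      with s show ?thesis by (intro that[of u]) (auto simp: ennreal_less_iff)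
    qed (auto intro: that[of "s + 1"])
    have "open (- A)" "X s \<omega> \<in> - A" using A s by auto
    from topological_tendstoD[OF path_right_continuous[OF \<omega> s(1)] this] obtain b where
      b: "s < b" "\<And>u. s < u \<Longrightarrow> u < b \<Longrightarrow> X u \<omega> \<in> - A"
      by (auto simp: eventually_at_right_field)
    obtain q where q: "q \<in> \<rat>" "s < q" "q < min b t'"
      using Rats_dense_in_real[of s "min b t'"] b t' by auto
    then have "ennreal q < ennreal t'" using s by (simp add: ennreal_less_iff)
    then show "\<exists>q\<in>?Q. X q \<omega> \<notin> A"
      using q s t' b(2)[of q] by (intro bexI[of _ q]) auto
  next
    assume "\<exists>q\<in>?Q. X q \<omega> \<notin> A"
    then obtain q where "0 \<le> q" "ennreal q < t" "X q \<omega> \<notin> A" by auto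
    then show "exit_time X A \<omega> < t" by (intro order.strict_trans1[OF exit_time_le])
  qed
  then have "{\<omega>\<in>\<Omega>. exit_time X A \<omega> < t} = (\<Union>q\<in>?Q. {\<omega>\<in>\<Omega>. X q \<omega> \<notin> A})" by auto
  also have "\<dots> \<in> sets (F t)"
  proof (rule sets.countable_UN'')
    show "countable ?Q" using countable_rat by (rule countable_subset[rotated]) auto
    fix q assume q: "q \<in> ?Q"
    have "X q -` (- A) \<inter> space (F t) \<in> sets (F t)"
      using q A by (intro measurable_sets[OF measurable_F_mono[OF adapted]]) auto
    moreover have "X q -` (- A) \<inter> space (F t) = {\<omega>\<in>\<Omega>. X q \<omega> \<notin> A}" by (auto simp: space_F)
    ultimately show "{\<omega>\<in>\<Omega>. X q \<omega> \<notin> A} \<in> sets (F t)" by simp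
  qed
  finally show "{\<omega>\<in>\<Omega>. exit_time X A \<omega> < t} \<in> sets (F t)" .
qed

text \<open>An increment after \<tau>, cut at 1 to be integrable. If \<tau> runs through times
  increasing to a limit and \<open>h\<close> is small, it captures the jump of the path at that
  limit.\<close>

definition jump :: "real \<Rightarrow> ('a \<Rightarrow> ennreal) \<Rightarrow> 'a \<Rightarrow> ennreal" where
  "jump h \<tau> \<omega> = (if \<tau> \<omega> < \<top>
     then ennreal (min 1 \<bar>X (enn2real (\<tau> \<omega>) + h) \<omega> - X (enn2real (\<tau> \<omega>)) \<omega>\<bar>) else 0)"

lemma borel_measurable_jump:
  assumes \<tau>: "stopping_time F \<tau>" and h: "0 \<le> h"
  shows "jump h \<tau> \<in> borel_measurable (P x)"
proof -
  note [measurable] = measurable_stopping_time_P[OF \<tau>]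
  have [measurable]: "(\<lambda>\<omega>. X (enn2real (\<tau> \<omega>) + c) \<omega>) \<in> borel_measurable (P x)" if "0 \<le> c" for c
    using that path_right_continuous
    by (intro measurable_at_stopping_time[OF \<tau>, where Y="\<lambda>s. X (s + c)"] measurable_X
        tendsto_at_right_shift) auto
  from this[OF h] this[OF order_refl] show ?thesis unfolding jump_def by simp
qed

text \<open>At a fixed time, independence and stationarity give equality; infinite times contribute
  0. The bound does not depend on \<tau>, so it survives a limit along a sequence of stopping
  times.\<close>

lemma nn_integral_jump_le:
  assumes \<tau>: "stopping_time F \<tau>" and h: "0 \<le> h"
  shows "(\<integral>\<^sup>+\<omega>. jump h \<tau> \<omega> \<partial>P x) \<le> (\<integral>\<^sup>+\<omega>. ennreal (min 1 \<bar>X h \<omega> - X 0 \<omega>\<bar>) \<partial>P 0)"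
proof -
  interpret x: prob_space "P x" by (rule prob_space_P)
  interpret o: prob_space "P 0" by (rule prob_space_P)
  let ?g = "\<integral>\<^sup>+\<omega>. ennreal (min 1 \<bar>X h \<omega> - X 0 \<omega>\<bar>) \<partial>P 0"
  have [measurable]: "X t \<in> borel_measurable (P y)" if "0 \<le> t" for t y
    using that by (rule measurable_X)
  have g1: "?g \<le> 1"
  proof -
    have "?g \<le> (\<integral>\<^sup>+\<omega>. 1 \<partial>P 0)" by (intro nn_integral_mono) (simp add: ennreal_le_1)
    then show ?thesis by (simp add: o.emeasure_space_1)
  qed
  have "(\<integral>\<^sup>+\<omega>. jump h \<tau> \<omega> \<partial>P x) = (\<integral>\<^sup>+\<omega>. (if \<tau> \<omega> < \<top> then ?g else 0) \<partial>P x)"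
    unfolding jump_def
  proof (rule nn_integral_stopping_time_cong[OF \<tau>, where c=1
        and Z="\<lambda>s \<omega>. ennreal (min 1 \<bar>X (s + h) \<omega> - X s \<omega>\<bar>)" and W="\<lambda>_ _. ?g"])
    fix t assume t: "0 \<le> (t::real)"
    then have [measurable]: "X (t + h) \<in> borel_measurable (P x)" "X t \<in> borel_measurable (P x)"
      using h by auto
    show "(\<lambda>\<omega>. ennreal (min 1 \<bar>X (t + h) \<omega> - X t \<omega>\<bar>)) \<in> borel_measurable (P x)"
      by measurable
    show "ennreal (min 1 \<bar>X (t + h) \<omega> - X t \<omega>\<bar>) \<le> 1" for \<omega> by (simp add: ennreal_le_1)
    show "((\<lambda>s. ennreal (min 1 \<bar>X (s + h) \<omega> - X s \<omega>\<bar>)) \<longlongrightarrow> ennreal (min 1 \<bar>X (t + h) \<omega> - X t \<omega>\<bar>)) (at_right t)"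
      if "\<omega> \<in> \<Omega>" for \<omega>
      using that t h by (intro tendsto_intros tendsto_ennrealI tendsto_at_right_shift path_right_continuous) auto
    fix A assume A: "A \<in> sets (F (ennreal t))"
    have "(\<integral>\<^sup>+\<omega>. ennreal (min 1 \<bar>X (t + h) \<omega> - X t \<omega>\<bar>) * indicator A \<omega> \<partial>P x)
        = (\<integral>\<^sup>+\<omega>. (\<lambda>p. ennreal (min 1 \<bar>snd p\<bar>) * fst p) (indicator A \<omega>, X (t + h) \<omega> - X t \<omega>) \<partial>P x)"
      by simp
    also have "\<dots> = (\<integral>\<^sup>+\<omega>. \<integral>\<^sup>+\<omega>'. (\<lambda>p. ennreal (min 1 \<bar>snd p\<bar>) * fst p) (indicator A \<omega>, X h \<omega>' - X 0 \<omega>') \<partial>P 0 \<partial>P x)"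
      by (rule nn_integral_increment[OF t h, where N=borel]) (use A in measurable)
    also have "\<dots> = (\<integral>\<^sup>+\<omega>. ?g * indicator A \<omega> \<partial>P x)"
      using h by (simp add: nn_integral_multc)
    finally show "(\<integral>\<^sup>+\<omega>. ennreal (min 1 \<bar>X (t + h) \<omega> - X t \<omega>\<bar>) * indicator A \<omega> \<partial>P x)
        = (\<integral>\<^sup>+\<omega>. ?g * indicator A \<omega> \<partial>P x)" .
  qed (use g1 in auto)
  also have "\<dots> \<le> (\<integral>\<^sup>+\<omega>. ?g \<partial>P x)"
    by (intro nn_integral_mono) simp
  finally show ?thesis by (simp add: x.emeasure_space_1)
qed

text \<open>Fatou's lemma twice: over the stopping times with \<open>h\<close> fixed, then over
  \<open>h\<close>. The uniform bounds tend to 0 because right-continuity of the paths at 0 gives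
  stochastic continuity there. The order matters: for fixed \<open>h\<close>, the time span after
  the stopping time eventually contains the limit point.\<close>

lemma AE_jump_liminf_zero:
  assumes T: "\<And>n. stopping_time F (T n)"
  shows "AE \<omega> in P x. liminf (\<lambda>k. liminf (\<lambda>n. jump (1 / real (Suc k)) (T n) \<omega>)) = 0"
proof -
  interpret o: prob_space "P 0" by (rule prob_space_P)
  let ?h = "\<lambda>k. 1 / real (Suc k)"
  let ?g = "\<lambda>h. \<integral>\<^sup>+\<omega>. ennreal (min 1 \<bar>X h \<omega> - X 0 \<omega>\<bar>) \<partial>P 0"
  have [measurable]: "jump (?h k) (T n) \<in> borel_measurable (P x)" for k n
    by (rule borel_measurable_jump[OF T]) simp
  have "(\<lambda>k. ?g (?h k)) \<longlonglongrightarrow> (\<integral>\<^sup>+\<omega>. 0 \<partial>P 0)"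
  proof (rule nn_integral_dominated_convergence[where w="\<lambda>_. 1"])
    show "(\<lambda>\<omega>. ennreal (min 1 \<bar>X (?h k) \<omega> - X 0 \<omega>\<bar>)) \<in> borel_measurable (P 0)" for k
      by (intro measurable_compose[OF _ measurable_ennreal] borel_measurable_min borel_measurable_abs
          borel_measurable_diff measurable_X) auto
    show "AE \<omega> in P 0. (\<lambda>k. ennreal (min 1 \<bar>X (?h k) \<omega> - X 0 \<omega>\<bar>)) \<longlonglongrightarrow> 0"
    proof (rule AE_I2)
      fix \<omega> assume "\<omega> \<in> space (P 0)"
      then have "((\<lambda>t. X t \<omega>) \<longlongrightarrow> X 0 \<omega>) (at_right 0)"
        by (intro path_right_continuous) (auto simp: space_P)
      moreover have "?h \<longlonglongrightarrow> 0" using LIMSEQ_Suc[OF lim_1_over_n] by simp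
      ultimately have "(\<lambda>k. X (?h k) \<omega>) \<longlonglongrightarrow> X 0 \<omega>"
        by (intro right_limit_sequentially[where f="\<lambda>t. X t \<omega>"]) auto
      then have "(\<lambda>k. ennreal (min 1 \<bar>X (?h k) \<omega> - X 0 \<omega>\<bar>)) \<longlonglongrightarrow> ennreal (min 1 \<bar>X 0 \<omega> - X 0 \<omega>\<bar>)"
        by (intro tendsto_intros tendsto_ennrealI)
      then show "(\<lambda>k. ennreal (min 1 \<bar>X (?h k) \<omega> - X 0 \<omega>\<bar>)) \<longlonglongrightarrow> 0" by simp
    qed
  qed (auto simp: o.emeasure_space_1 ennreal_le_1)
  then have g0: "liminf (\<lambda>k. ?g (?h k)) = 0"
    using lim_imp_Liminf[OF sequentially_bot] by fastforce
  have "(\<integral>\<^sup>+\<omega>. liminf (\<lambda>k. liminf (\<lambda>n. jump (?h k) (T n) \<omega>)) \<partial>P x)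
      \<le> liminf (\<lambda>k. \<integral>\<^sup>+\<omega>. liminf (\<lambda>n. jump (?h k) (T n) \<omega>) \<partial>P x)"
    by (rule nn_integral_liminf) measurable
  also have "\<dots> \<le> liminf (\<lambda>k. ?g (?h k))"
  proof (rule Liminf_mono[OF always_eventually], rule allI)
    fix k
    have "(\<integral>\<^sup>+\<omega>. liminf (\<lambda>n. jump (?h k) (T n) \<omega>) \<partial>P x) \<le> liminf (\<lambda>n. \<integral>\<^sup>+\<omega>. jump (?h k) (T n) \<omega> \<partial>P x)"
      by (rule nn_integral_liminf) measurable
    also have "\<dots> \<le> liminf (\<lambda>n::nat. ?g (?h k))"
      by (intro Liminf_mono always_eventually allI nn_integral_jump_le T) simp
    also have "\<dots> = ?g (?h k)" by (simp add: Liminf_const)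
    finally show "(\<integral>\<^sup>+\<omega>. liminf (\<lambda>n. jump (?h k) (T n) \<omega>) \<partial>P x) \<le> ?g (?h k)" .
  qed
  also have "\<dots> = 0" by (rule g0)
  finally have "(\<integral>\<^sup>+\<omega>. liminf (\<lambda>k. liminf (\<lambda>n. jump (?h k) (T n) \<omega>)) \<partial>P x) = 0"
    by (rule le_zero_eq[THEN iffD1])
  moreover have "(\<lambda>\<omega>. liminf (\<lambda>k. liminf (\<lambda>n. jump (?h k) (T n) \<omega>))) \<in> borel_measurable (P x)"
    by measurable
  ultimately show ?thesis using nn_integral_0_iff_AE by blast
qed

text \<open>For fixed small \<open>h\<close> and \<open>t n\<close> close to \<open>t0\<close>, the
  increment starts just before \<open>t0\<close> and ends just after it, so it contains a possible
  jump at \<open>t0\<close>. A jump would then keep the inner lower limits away from 0.\<close>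

lemma no_jump_at_limit:
  assumes \<omega>: "\<omega> \<in> \<Omega>" and t: "t \<longlonglongrightarrow> t0" "\<And>n. t n < t0" "\<And>n. 0 \<le> t n" and T: "\<And>n. T n \<omega> = ennreal (t n)"
    and L: "((\<lambda>s. X s \<omega>) \<longlongrightarrow> L) (at_left t0)"
    and zero: "liminf (\<lambda>k. liminf (\<lambda>n. jump (1 / real (Suc k)) (T n) \<omega>)) = 0"
  shows "X t0 \<omega> = L"
proof (rule ccontr)
  assume neq: "X t0 \<omega> \<noteq> L"
  \<comment> \<open>One quarter of the jump: the two approximation errors are below \<open>d\<close>
    each, and of the total \<open>4 * d\<close> more than \<open>d\<close> remains.\<close>
  define d where "d = \<bar>X t0 \<omega> - L\<bar> / 4"
  have d: "0 < d" using neq by (simp add: d_def)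
  have t0: "0 \<le> t0" using t(2,3)[of 0] by simp
  have "eventually (\<lambda>s. dist (X s \<omega>) (X t0 \<omega>) < d) (at_right t0)"
    using tendstoD[OF path_right_continuous[OF \<omega> t0] d] .
  then obtain b where b: "t0 < b" "\<And>s. t0 < s \<Longrightarrow> s < b \<Longrightarrow> \<bar>X s \<omega> - X t0 \<omega>\<bar> < d"
    by (auto simp: eventually_at_right_field dist_real_def)
  have "eventually (\<lambda>s. dist (X s \<omega>) L < d) (at_left t0)"
    using tendstoD[OF L d] .
  then obtain a where a: "a < t0" "\<And>s. a < s \<Longrightarrow> s < t0 \<Longrightarrow> \<bar>X s \<omega> - L\<bar> < d"
    by (auto simp: eventually_at_left_field dist_real_def)
  have "eventually (\<lambda>k. 1 / real (Suc k) < b - t0) sequentially"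
    using order_tendstoD(2)[OF LIMSEQ_Suc[OF lim_1_over_n], of "b - t0"] b by simp
  then have "eventually (\<lambda>k. ennreal (min 1 d) \<le> liminf (\<lambda>n. jump (1 / real (Suc k)) (T n) \<omega>)) sequentially"
  proof eventually_elim
    case (elim k)
    \<comment> \<open>Beyond \<open>t0 - h\<close> the increment ends after \<open>t0\<close>, and
      it ends before \<open>b\<close> because \<open>h < b - t0\<close>; beyond \<open>a\<close> it
      starts near the left limit.\<close>
    have "eventually (\<lambda>n. max a (t0 - 1 / real (Suc k)) < t n) sequentially"
      using a by (intro order_tendstoD(1)[OF t(1)]) auto
    then have "eventually (\<lambda>n. ennreal (min 1 d) \<le> jump (1 / real (Suc k)) (T n) \<omega>) sequentially"
    proof eventually_elim
      case (elim n)
      have "\<bar>X (t n) \<omega> - L\<bar> < d" using elim t by (intro a) auto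
      moreover have "\<bar>X (t n + 1 / real (Suc k)) \<omega> - X t0 \<omega>\<bar> < d"
        using elim t(2)[of n] \<open>1 / real (Suc k) < b - t0\<close> by (intro b) linarith+
      moreover have "\<bar>X t0 \<omega> - L\<bar> = 4 * d" by (simp add: d_def)
      ultimately have "d \<le> \<bar>X (t n + 1 / real (Suc k)) \<omega> - X (t n) \<omega>\<bar>" by linarith
      then show ?case using T t(3) by (simp add: jump_def ennreal_leI min.coboundedI2)
    qed
    then show ?case by (rule Liminf_bounded)
  qed
  then have "ennreal (min 1 d) \<le> liminf (\<lambda>k. liminf (\<lambda>n. jump (1 / real (Suc k)) (T n) \<omega>))"
    by (rule Liminf_bounded)
  with zero d show False by (simp add: ennreal_eq_0_iff min_def split: if_splits)
qed

text \<open>The exit times from the sets \<open>shrunk A n\<close> announce their limit, so that a Levy process almost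
  surely does not jump there. Without this, a path could approach the boundary of \<open>A\<close> and jump back
  inside, and the limit would come before the exit from \<open>A\<close>.\<close>
lemma exit_time_eq_SUP_shrunk:
  assumes \<omega>: "\<omega> \<in> \<Omega>" and A: "open A"
    and zero: "liminf (\<lambda>k. liminf (\<lambda>n. jump (1 / real (Suc k)) (exit_time X (shrunk A n)) \<omega>)) = 0"
  shows "(SUP n. exit_time X (shrunk A n) \<omega>) = exit_time X A \<omega>"
proof (rule antisym)
  show "(SUP n. exit_time X (shrunk A n) \<omega>) \<le> exit_time X A \<omega>"
    by (intro SUP_least exit_time_mono shrunk_subset)
  show "exit_time X A \<omega> \<le> (SUP n. exit_time X (shrunk A n) \<omega>)"
  proof (cases "SUP n. exit_time X (shrunk A n) \<omega>")
    case (real t0)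
    define t where "t n = enn2real (exit_time X (shrunk A n) \<omega>)" for n
    have le: "exit_time X (shrunk A n) \<omega> \<le> ennreal t0" for n
      by (rule order_trans[OF SUP_upper eq_refl[OF real(2)]]) simp
    have t: "exit_time X (shrunk A n) \<omega> = ennreal (t n)" for n
      using order.strict_trans1[OF le[of n] ennreal_less_top] by (simp add: t_def)
    have t_pos: "0 \<le> t n" for n by (simp add: t_def)
    have t_le: "t n \<le> t0" for n using le[of n] real(1) unfolding t by simp
    have inc: "incseq t"
    proof (rule monoI)
      fix m n :: nat assume "m \<le> n"
      then have "exit_time X (shrunk A m) \<omega> \<le> exit_time X (shrunk A n) \<omega>"
        by (intro exit_time_mono shrunk_mono)
      then show "t m \<le> t n" using t_pos[of n] by (simp add: t)
    qed
    have "incseq (\<lambda>n. ennreal (t n))" using inc by (auto simp: incseq_def intro: ennreal_leI)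
    from LIMSEQ_SUP[OF this] have "(\<lambda>n. ennreal (t n)) \<longlonglongrightarrow> ennreal t0"
      using real(2) by (simp add: t)
    then have lim: "t \<longlonglongrightarrow> t0" using real t_pos by (subst (asm) tendsto_ennreal_iff) auto
    have not_int: "X (t n) \<omega> \<notin> interior (shrunk A n)" for n
      using t[of n] t_pos by (intro at_exit_time path_right_continuous \<omega>) auto
    have "X t0 \<omega> \<notin> A"
    proof
      assume "X t0 \<omega> \<in> A"
      then obtain m where m: "X t0 \<omega> \<in> interior (shrunk A m)" by (rule in_interior_shrunk[OF A])
      have int: "interior (shrunk A m) \<subseteq> interior (shrunk A n)" if "m \<le> n" for n
        using that by (intro interior_mono shrunk_mono)
      show False
      \<comment> \<open>If some exit time already equals the limit, so do all later ones, and the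
        path at \<open>t0\<close> is outside the interior of arbitrarily large closed sets. Only a
        strictly increasing approach requires the absence of a jump.\<close>
      proof (cases "\<exists>n. t n = t0")
        case True
        then obtain n where "t n = t0" ..
        then have "t (max m n) = t0"
          using t_le[of "max m n"] incseqD[OF inc, of n "max m n"] by simp
        with not_int[of "max m n"] int[of "max m n"] m show False by auto
      next
        case False
        then have less: "t n < t0" for n using t_le[of n] by (auto simp: less_le)
        \<comment> \<open>Left limits exist at positive times only, so \<open>0 < t0\<close> has to
          be derived.\<close>
        from le_less_trans[OF t_pos[of 0] less[of 0]]
        obtain L where L: "((\<lambda>s. X s \<omega>) \<longlongrightarrow> L) (at_left t0)"
          using paths[OF \<omega>] by (auto simp: cadlag_def)
        have "X t0 \<omega> = L"
          by (rule no_jump_at_limit[OF \<omega> lim less t_pos t L zero])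
        moreover have "filterlim t (at_left t0) sequentially"
          using lim less by (intro tendsto_imp_filterlim_at_left always_eventually) auto
        ultimately have "(\<lambda>n. X (t n) \<omega>) \<longlonglongrightarrow> X t0 \<omega>"
          using filterlim_compose[OF L] by simp
        from topological_tendstoD[OF this open_interior m]
        have "eventually (\<lambda>n. X (t n) \<omega> \<in> interior (shrunk A m) \<and> m \<le> n) sequentially"
          by (intro eventually_conj eventually_ge_at_top)
        then obtain n where "X (t n) \<omega> \<in> interior (shrunk A m)" "m \<le> n"
          by (auto simp: eventually_sequentially)
        with not_int[of n] int[of n] show False by auto
      qed
    qed
    then show ?thesis using exit_time_le[of t0 X \<omega> A] real by simp
  qed (simp only: top_greatest)
qed

lemma stopping_time_exit_open:
  assumes A: "open A"
  shows "stopping_time F (exit_time X A)"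
proof (rule stopping_time_AE_cong)
  have T: "stopping_time F (exit_time X (shrunk A n))" for n
    by (intro stopping_time_exit_closed closed_shrunk)
  show "stopping_time F (\<lambda>\<omega>. SUP n. exit_time X (shrunk A n) \<omega>)"
    using T unfolding stopping_time_def SUP_le_iff by (auto intro!: pred_intros_countable)
  show "AE \<omega> in P x. (SUP n. exit_time X (shrunk A n) \<omega>) = exit_time X A \<omega>" for x
    using AE_jump_liminf_zero[OF T, where x=x] AE_space
    by eventually_elim (auto simp: space_P intro!: exit_time_eq_SUP_shrunk A)
qed

end

section \<open>Optimal stopping\<close>

lemma ennreal_discounted_reward:
  assumes "\<forall>x. 0 \<le> g x"
  shows "ennreal (discounted_reward r g X \<tau> \<omega>) = (if \<tau> \<omega> < \<top>
    then ennreal (exp (- r * enn2real (\<tau> \<omega>))) * ennreal (g (X (enn2real (\<tau> \<omega>)) \<omega>)) else 0)"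
  using assms by (simp add: discounted_reward_def ennreal_mult)

lemma running_inf_eq: "running_inf X e \<omega> = - running_sup (\<lambda>t \<omega>. - X t \<omega>) e \<omega>"
  by (simp add: running_inf_def running_sup_def Inf_real_def image_comp o_def)

section \<open>Independence under modification and composition\<close>

lemma (in prob_space) indep_set_commute: "indep_set A B \<Longrightarrow> indep_set B A"
  unfolding indep_sets2_eq by (metis Int_commute mult.commute)

text \<open>The generated sigma-algebras may differ, but corresponding preimages have the same
  probabilities. This transfers the independence assumptions to the modified process.\<close>

lemma (in prob_space) indep_set_vimage_AE_cong:
  assumes ind: "indep_set (sets (vimage_algebra (space M) f N)) B"
    and f: "f \<in> measurable M N" and f': "f' \<in> measurable M N" and eq: "AE \<omega> in M. f \<omega> = f' \<omega>"
  shows "indep_set (sets (vimage_algebra (space M) f' N)) B"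
proof -
  have vim: "f \<in> space M \<rightarrow> space N" "f' \<in> space M \<rightarrow> space N"
    using f f' by (auto dest: measurable_space)
  have "prob (f' -` E \<inter> space M \<inter> b) = prob (f' -` E \<inter> space M) * prob b"
    if E: "E \<in> sets N" and b: "b \<in> B" for E b
  proof -
    from b ind have b_ev: "b \<in> events" by (auto simp: indep_sets2_eq)
    have "prob (f' -` E \<inter> space M) = prob (f -` E \<inter> space M)"
      using eq measurable_sets[OF f E] measurable_sets[OF f' E] by (intro finite_measure_eq_AE) auto
    moreover have "prob (f' -` E \<inter> space M \<inter> b) = prob (f -` E \<inter> space M \<inter> b)"
      using eq measurable_sets[OF f E] measurable_sets[OF f' E] b_ev by (intro finite_measure_eq_AE) auto
    moreover have "f -` E \<inter> space M \<in> sets (vimage_algebra (space M) f N)"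
      using E by (rule in_vimage_algebra)
    ultimately show ?thesis using indep_setD[OF ind _ b] by simp
  qed
  then show ?thesis
    using ind measurable_sets[OF f'] unfolding indep_sets2_eq sets_vimage_algebra2[OF vim(2)] by auto
qed

lemma (in prob_space) indep_set_vimage_compose:
  assumes ind: "indep_set (sets (vimage_algebra (space M) f N)) B"
    and f: "f \<in> space M \<rightarrow> space N" and h: "h \<in> measurable N K"
  shows "indep_set (sets (vimage_algebra (space M) (\<lambda>\<omega>. h (f \<omega>)) K)) B"
proof -
  have hf: "(\<lambda>\<omega>. h (f \<omega>)) \<in> space M \<rightarrow> space K"
    using f measurable_space[OF h] by auto
  have "sets (vimage_algebra (space M) (\<lambda>\<omega>. h (f \<omega>)) K) \<subseteq> sets (vimage_algebra (space M) f N)"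
  proof
    fix C assume "C \<in> sets (vimage_algebra (space M) (\<lambda>\<omega>. h (f \<omega>)) K)"
    then obtain E where E: "E \<in> sets K" "C = (\<lambda>\<omega>. h (f \<omega>)) -` E \<inter> space M"
      by (auto simp: sets_vimage_algebra2[OF hf])
    then have "C = f -` (h -` E \<inter> space N) \<inter> space M" using f by auto
    then show "C \<in> sets (vimage_algebra (space M) f N)"
      using in_vimage_algebra[OF measurable_sets[OF h E(1)], of f "space M"] by simp
  qed
  with ind show ?thesis by (auto simp: indep_sets2_eq)
qed

section \<open>Reflection and the solution for regular paths\<close>

context regular_levy_process
begin

text \<open>The real supremum is meaningful because the path is bounded on compact intervals and
  \<open>e\<close> is nonnegative almost surely. A continuous monotone function commutes with it,
  which leaves a supremum to which the Markov results apply.\<close>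

lemma AE_running_sup:
  fixes Q :: "real \<Rightarrow> real"
  assumes Q: "continuous_on UNIV Q" "mono Q" and e: "independent_exponential_time P X r e"
  shows "AE \<omega> in P y. ennreal (Q (running_sup X e \<omega>)) = (SUP t\<in>{0..max 0 (e \<omega>)}. ennreal (Q (X t \<omega>)))"
  using independent_exponential_time_nonneg[OF e, of y] AE_space
proof eventually_elim
  case (elim \<omega>)
  have "continuous_on UNIV (\<lambda>x. ennreal (Q x))"
    using Q(1) by (intro continuous_on_ennreal)
  then have "continuous (at_left (Sup ((\<lambda>t. X t \<omega>) ` {0..e \<omega>}))) (\<lambda>x. ennreal (Q x))"
    by (simp add: continuous_on_eq_continuous_at continuous_at_imp_continuous_at_within)
  moreover have "mono (\<lambda>x. ennreal (Q x))"
    using Q(2) by (auto simp: mono_def intro: ennreal_leI)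
  moreover have "bdd_above ((\<lambda>t. X t \<omega>) ` {0..e \<omega>})"
    using elim by (intro cadlag_bdd_above paths) (auto simp: space_P)
  ultimately have "ennreal (Q (Sup ((\<lambda>t. X t \<omega>) ` {0..e \<omega>})))
      = (SUP s\<in>(\<lambda>t. X t \<omega>) ` {0..e \<omega>}. ennreal (Q s))"
    using elim by (intro continuous_at_Sup_mono) auto
  with elim show ?case by (simp add: running_sup_def image_comp o_def max_def)
qed

lemma borel_measurable_exp_time_sup:
  assumes q: "continuous_on UNIV q" and e: "independent_exponential_time P X r e"
  shows "(\<lambda>\<omega>. SUP t\<in>{0..max 0 (e \<omega>)}. q (X t \<omega>) :: ennreal) \<in> borel_measurable (P y)"
proof -
  have "e \<in> borel_measurable (P y)"
    using e by (auto simp: independent_exponential_time_def distributed_def)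
  then have "(\<lambda>\<omega>. (\<omega>, e \<omega>)) \<in> measurable (P y) (P y \<Otimes>\<^sub>M borel)" by measurable
  from measurable_compose[OF this borel_measurable_path_sup_prod[OF q space_P measurable_X]]
  show ?thesis by simp
qed

lemma nn_integral_exp_time_sup_max:
  assumes q: "continuous_on UNIV q" and e: "independent_exponential_time P X r e"
  shows "(\<integral>\<^sup>+\<omega>. (SUP t\<in>{0..max 0 (e \<omega>)}. q (X t \<omega>)) \<partial>P y) = exp_sup_mean r q y"
  unfolding nn_integral_exp_time_sup[OF q e, symmetric]
  using independent_exponential_time_nonneg[OF e, of y] by (intro nn_integral_cong_AE) (auto simp: max_def)

text \<open>Reflection turns infima into suprema. The measures are reindexed because
  \<open>- X\<close> starts from \<open>x\<close> under \<open>P (- x)\<close>.\<close>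

lemma dual: "regular_levy_process \<Omega> F (\<lambda>x. P (- x)) (\<lambda>t \<omega>. - X t \<omega>)"
proof (intro regular_levy_process.intro levy_process.intro stochastic_basis.intro
    stochastic_basis_axioms.intro levy_process_axioms.intro regular_levy_process_axioms.intro)
  show "filtration \<Omega> F" ..
  show "prob_space (P (- x))" for x by (rule prob_space_P)
  show "sets (P (- x)) = sets (F \<top>)" for x by (rule sets_P)
  show "sets (F t) = (\<Inter>u\<in>{t<..}. sets (F u))" if "t < \<top>" for t by (rule right_continuous[OF that])
  show "N \<in> sets (F 0)" if "\<And>x. \<exists>B\<in>null_sets (P (- x)). N \<subseteq> B" for N
    using that[of "- x" for x] by (intro complete) simp
  show "(\<lambda>\<omega>. - X t \<omega>) \<in> borel_measurable (F (ennreal t))" if "0 \<le> t" for t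
    using adapted[OF that] by simp
  show "AE \<omega> in P (- x). - X 0 \<omega> = x" for x
    using starts_at[of "- x"] by eventually_elim simp
  have neg: "cadlag (\<lambda>t. - f t)" if "cadlag f" for f
    unfolding cadlag_def
  proof (intro conjI allI impI)
    fix t :: real assume "0 \<le> t"
    with that show "continuous (at_right t) (\<lambda>t. - f t)"
      by (auto simp: cadlag_def intro: continuous_minus)
  next
    fix t :: real assume "0 < t"
    with that obtain l where "(f \<longlongrightarrow> l) (at_left t)" by (auto simp: cadlag_def)
    from tendsto_minus[OF this] show "\<exists>l. ((\<lambda>t. - f t) \<longlongrightarrow> l) (at_left t)" ..
  qed
  show "cadlag (\<lambda>t. - X t \<omega>)" if "\<omega> \<in> \<Omega>" for \<omega>
    by (rule neg[OF paths[OF that]])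
  then show "AE \<omega> in P (- x). cadlag (\<lambda>t. - X t \<omega>)" for x
    by (intro AE_I2) (simp add: space_P)
  show "prob_space.indep_set (P (- x)) (sets (F (ennreal s)))
      (sets (vimage_algebra \<Omega> (\<lambda>\<omega>. - X t \<omega> - - X s \<omega>) borel))" if "0 \<le> s" "s < t" for x s t
  proof -
    interpret x: prob_space "P (- x)" by (rule prob_space_P)
    have "x.indep_set (sets (vimage_algebra (space (P (- x))) (\<lambda>\<omega>. X t \<omega> - X s \<omega>) borel)) (sets (F (ennreal s)))"
      using x.indep_set_commute[OF independent_increments[OF that, of "- x"]] by (simp add: space_P)
    from x.indep_set_vimage_compose[OF this, where h=uminus and K=borel]
    have "x.indep_set (sets (vimage_algebra \<Omega> (\<lambda>\<omega>. - (X t \<omega> - X s \<omega>)) borel)) (sets (F (ennreal s)))"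
      by (simp add: space_P)
    from x.indep_set_commute[OF this] show ?thesis by simp
  qed
  show "distr (P (- x)) borel (\<lambda>\<omega>. - X (s + h) \<omega> - - X s \<omega>) = distr (P (- 0)) borel (\<lambda>\<omega>. - X h \<omega> - - X 0 \<omega>)"
    if "0 \<le> s" "0 \<le> h" for x s h
  proof -
    have minus: "distr (P y) borel (\<lambda>\<omega>. - X b \<omega> - - X a \<omega>)
        = distr (distr (P y) borel (\<lambda>\<omega>. X b \<omega> - X a \<omega>)) borel uminus" if "0 \<le> a" "0 \<le> b" for y a b
      using measurable_X[OF that(1)] measurable_X[OF that(2)]
      by (subst distr_distr) (auto simp: o_def)
    show ?thesis
      using that stationary_increments[OF that, of "- x"] minus[of s "s + h" "- x"] minus[of 0 h 0] by simp
  qed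
qed

lemma dual_independent_exponential_time:
  assumes e: "independent_exponential_time P X r e"
  shows "independent_exponential_time (\<lambda>x. P (- x)) (\<lambda>t \<omega>. - X t \<omega>) r e"
  unfolding independent_exponential_time_def
proof (intro allI conjI)
  fix x
  interpret prob_space "P (- x)" by (rule prob_space_P)
  let ?Pi = "Pi\<^sub>M {0..} (\<lambda>_. borel) :: (real \<Rightarrow> real) measure"
  show "distributed (P (- x)) lborel e (exponential_density r)"
    using e by (simp add: independent_exponential_time_def)
  have ind: "indep_set (sets (vimage_algebra (space (P (- x))) (\<lambda>\<omega>. \<lambda>t\<in>{0..}. X t \<omega>) ?Pi))
      (sets (vimage_algebra (space (P (- x))) e borel))"
    using e by (simp add: independent_exponential_time_def)
  have h: "(\<lambda>f. \<lambda>t\<in>{0..}. - f t) \<in> measurable ?Pi ?Pi"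
    by (intro measurable_restrict borel_measurable_uminus measurable_component_singleton)
  have "(\<lambda>\<omega>. \<lambda>t\<in>{0..}. - (\<lambda>t\<in>{0..}. X t \<omega>) t) = (\<lambda>\<omega>. \<lambda>t\<in>{0..}. - X t \<omega>)" by (auto simp: fun_eq_iff)
  with indep_set_vimage_compose[OF ind _ h]
  show "indep_set (sets (vimage_algebra (space (P (- x))) (\<lambda>\<omega>. \<lambda>t\<in>{0..}. - X t \<omega>) ?Pi))
      (sets (vimage_algebra (space (P (- x))) e borel))"
    by (simp add: space_PiM)
qed

text \<open>The two parts of \<open>V\<close> are treated separately, and one exit time serves both:
  \<open>Q1\<close> vanishes to the right of \<open>a\<close> and \<open>Q2\<close> to the left of
  \<open>b\<close>, so on the interval between them neither part loses anything by waiting.\<close>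

lemma optimal_stopping:
  fixes V :: "real \<Rightarrow> ennreal"
  assumes r: "0 < r"
    and e: "independent_exponential_time P X r e"
    and g: "\<forall>x. 0 \<le> g x"
    and Q1: "continuous_on UNIV Q1" "antimono Q1" "\<forall>x\<ge>a. Q1 x = 0"
    and Q2: "continuous_on UNIV Q2" "mono Q2" "\<forall>x\<le>b. Q2 x = 0"
    and g_eq: "\<forall>x. x \<notin> {a<..<b} \<longrightarrow>
      ennreal (g x) = expectation_nonneg (P x) (\<lambda>\<omega>. Q1 (running_inf X e \<omega>))
                    + expectation_nonneg (P x) (\<lambda>\<omega>. Q2 (running_sup X e \<omega>))"
    and V: "\<forall>x. V x =
      expectation_nonneg (P x) (\<lambda>\<omega>. Q1 (running_inf X e \<omega>) + Q2 (running_sup X e \<omega>))"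
    and V_ge: "\<forall>x\<in>{a..b}. ennreal (g x) \<le> V x"
  shows "stopping_time F (exit_time X {a<..<b})"
    and "stopping_time F \<tau> \<Longrightarrow> expectation_nonneg (P x) (discounted_reward r g X \<tau>) \<le> V x"
    and "expectation_nonneg (P x) (discounted_reward r g X (exit_time X {a<..<b})) = V x"
proof -
  interpret D: regular_levy_process \<Omega> F "\<lambda>x. P (- x)" "\<lambda>t \<omega>. - X t \<omega>" by (rule dual)
  let ?q1 = "\<lambda>z. ennreal (Q1 (- z))" and ?q2 = "\<lambda>z. ennreal (Q2 z)"
  \<comment> \<open>The argument is negated because under \<open>P x\<close> the reflected process
    starts from \<open>- x\<close>.\<close>
  define v1 where "v1 x = D.exp_sup_mean r ?q1 (- x)" for x
  define v2 where "v2 = exp_sup_mean r ?q2"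
  have Q1_dual: "continuous_on UNIV (\<lambda>z. Q1 (- z))" "mono (\<lambda>z. Q1 (- z))"
    using Q1 by (auto intro!: continuous_on_compose2[OF Q1(1)] continuous_intros simp: mono_def antimono_def)
  have q1: "continuous_on UNIV ?q1" and q2: "continuous_on UNIV ?q2"
    using Q1_dual(1) Q2(1) by (auto intro: continuous_on_ennreal)
  have De: "independent_exponential_time (\<lambda>x. P (- x)) (\<lambda>t \<omega>. - X t \<omega>) r e"
    by (rule dual_independent_exponential_time[OF e])
  let ?S1 = "\<lambda>\<omega>. SUP t\<in>{0..max 0 (e \<omega>)}. ?q1 (- X t \<omega>)" and ?S2 = "\<lambda>\<omega>. SUP t\<in>{0..max 0 (e \<omega>)}. ?q2 (X t \<omega>)"
  have S1: "AE \<omega> in P x. ennreal (Q1 (running_inf X e \<omega>)) = ?S1 \<omega>" for x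
    using D.AE_running_sup[OF Q1_dual De, of "- x", unfolded minus_minus] by (simp add: running_inf_eq)
  have S2: "AE \<omega> in P x. ennreal (Q2 (running_sup X e \<omega>)) = ?S2 \<omega>" for x
    by (rule AE_running_sup[OF Q2(1,2) e])
  have v1: "(\<integral>\<^sup>+\<omega>. ?S1 \<omega> \<partial>P x) = v1 x" for x
    using D.nn_integral_exp_time_sup_max[OF q1 De, of "- x"] by (simp add: v1_def)
  have v2: "(\<integral>\<^sup>+\<omega>. ?S2 \<omega> \<partial>P x) = v2 x" for x
    unfolding v2_def by (rule nn_integral_exp_time_sup_max[OF q2 e])
  have [measurable]: "?S1 \<in> borel_measurable (P x)" "?S2 \<in> borel_measurable (P x)" for x
    using D.borel_measurable_exp_time_sup[OF q1 De, of "- x"] borel_measurable_exp_time_sup[OF q2 e, of x]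
    by simp_all
  \<comment> \<open>Monotonicity and vanishing on a half-line force nonnegativity. Therefore
    \<open>ennreal\<close> truncates nothing and is additive on \<open>Q1\<close> and
    \<open>Q2\<close>.\<close>
  have Q1_nonneg: "0 \<le> Q1 z" for z
    using Q1(3) antimonoD[OF Q1(2), of z "max z a"] by simp
  have Q2_nonneg: "0 \<le> Q2 z" for z
    using Q2(3) monoD[OF Q2(2), of "min z b" z] by simp
  have V_sum: "V x = v1 x + v2 x" for x
  proof -
    have "V x = (\<integral>\<^sup>+\<omega>. ?S1 \<omega> + ?S2 \<omega> \<partial>P x)"
      unfolding V[rule_format] expectation_nonneg_def
    proof (rule nn_integral_cong_AE)
      show "AE \<omega> in P x. ennreal (Q1 (running_inf X e \<omega>) + Q2 (running_sup X e \<omega>)) = ?S1 \<omega> + ?S2 \<omega>"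
        using S1[of x] S2[of x] by eventually_elim (simp add: Q1_nonneg Q2_nonneg)
    qed
    also have "\<dots> = v1 x + v2 x"
      unfolding v1[symmetric] v2[symmetric] by (rule nn_integral_add) measurable
    finally show ?thesis .
  qed
  have g_V: "ennreal (g x) = V x" if "x \<notin> {a<..<b}" for x
  proof -
    have "(\<integral>\<^sup>+\<omega>. ennreal (Q1 (running_inf X e \<omega>)) \<partial>P x) = v1 x"
      unfolding v1[symmetric] by (rule nn_integral_cong_AE[OF S1])
    moreover have "(\<integral>\<^sup>+\<omega>. ennreal (Q2 (running_sup X e \<omega>)) \<partial>P x) = v2 x"
      unfolding v2[symmetric] by (rule nn_integral_cong_AE[OF S2])
    ultimately show ?thesis
      using g_eq that by (simp add: expectation_nonneg_def V_sum)
  qed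
  \<comment> \<open>Outside the interval this is equality, inside it is the assumption
    \<open>V_ge\<close>; together they give domination at every possible stopping position.\<close>
  have g_le: "ennreal (g x) \<le> V x" for x
    using g_V[of x] V_ge by (cases "x \<in> {a<..<b}") auto
  define W where "W v \<tau> \<omega> = (if \<tau> \<omega> < \<top> then ennreal (exp (- r * enn2real (\<tau> \<omega>)))
      * v (X (enn2real (\<tau> \<omega>)) \<omega>) else 0)" for v :: "real \<Rightarrow> ennreal" and \<tau> \<omega>
  have [measurable]: "v1 \<in> borel_measurable borel" "v2 \<in> borel_measurable borel"
    using D.borel_measurable_exp_sup_mean[OF q1] borel_measurable_exp_sup_mean[OF q2]
    unfolding v1_def[abs_def] v2_def by simp_all
  have W_sum: "(\<integral>\<^sup>+\<omega>. W V \<tau> \<omega> \<partial>P x) = (\<integral>\<^sup>+\<omega>. W v1 \<tau> \<omega> \<partial>P x) + (\<integral>\<^sup>+\<omega>. W v2 \<tau> \<omega> \<partial>P x)"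
    if \<tau>: "stopping_time F \<tau>" for \<tau> x
  proof -
    note [measurable] = measurable_stopping_time_P[OF \<tau>]
    have [measurable]: "(\<lambda>\<omega>. X (enn2real (\<tau> \<omega>)) \<omega>) \<in> borel_measurable (P x)"
      by (rule measurable_at_stopping_time[OF \<tau>]) (rule measurable_X path_right_continuous; assumption)+
    have "(\<integral>\<^sup>+\<omega>. W V \<tau> \<omega> \<partial>P x) = (\<integral>\<^sup>+\<omega>. W v1 \<tau> \<omega> + W v2 \<tau> \<omega> \<partial>P x)"
      by (intro nn_integral_cong) (simp add: W_def V_sum distrib_left)
    also have "\<dots> = (\<integral>\<^sup>+\<omega>. W v1 \<tau> \<omega> \<partial>P x) + (\<integral>\<^sup>+\<omega>. W v2 \<tau> \<omega> \<partial>P x)"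
      unfolding W_def by (rule nn_integral_add) measurable
    finally show ?thesis .
  qed
  have W_v1: "W v1 \<tau> \<omega> = (if \<tau> \<omega> < \<top> then ennreal (exp (- r * enn2real (\<tau> \<omega>)))
      * D.exp_sup_mean r ?q1 (- X (enn2real (\<tau> \<omega>)) \<omega>) else 0)" for \<tau> \<omega>
    by (simp add: W_def v1_def)
  show stop: "stopping_time F (exit_time X {a<..<b})"
    by (rule stopping_time_exit_open) simp
  show "expectation_nonneg (P x) (discounted_reward r g X \<tau>) \<le> V x" if \<tau>: "stopping_time F \<tau>"
  proof -
    have "expectation_nonneg (P x) (discounted_reward r g X \<tau>) \<le> (\<integral>\<^sup>+\<omega>. W V \<tau> \<omega> \<partial>P x)"
      unfolding expectation_nonneg_def ennreal_discounted_reward[OF g] W_def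
      by (intro nn_integral_mono) (auto intro: mult_left_mono g_le)
    also have "\<dots> \<le> v1 x + v2 x"
      unfolding W_sum[OF \<tau>]
    proof (rule add_mono)
      show "(\<integral>\<^sup>+\<omega>. W v1 \<tau> \<omega> \<partial>P x) \<le> v1 x"
        using D.exp_sup_mean_stopped_le[OF r q1 \<tau>, of "- x"] unfolding W_v1 by (simp add: v1_def)
      show "(\<integral>\<^sup>+\<omega>. W v2 \<tau> \<omega> \<partial>P x) \<le> v2 x"
        unfolding W_def v2_def by (rule exp_sup_mean_stopped_le[OF r q2 \<tau>])
    qed
    finally show ?thesis by (simp add: V_sum)
  qed
  show "expectation_nonneg (P x) (discounted_reward r g X (exit_time X {a<..<b})) = V x"
  proof -
    let ?\<tau> = "exit_time X {a<..<b}"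
    have inside: "a < X t \<omega> \<and> X t \<omega> < b" if "0 \<le> t" "ennreal t < ?\<tau> \<omega>" for t \<omega>
      using before_exit_time[OF that] by simp
    \<comment> \<open>The interval is open, hence its own interior, so at a finite exit time the
      path is at a point where \<open>g\<close> and \<open>V\<close> agree.\<close>
    have exit: "X (enn2real (?\<tau> \<omega>)) \<omega> \<notin> {a<..<b}" if "\<omega> \<in> \<Omega>" "?\<tau> \<omega> < \<top>" for \<omega>
      using at_exit_time[where X=X, OF path_right_continuous[OF that(1) enn2real_nonneg], of "?\<tau> \<omega>" "{a<..<b}"] that(2)
      by (simp add: interior_open)
    have "expectation_nonneg (P x) (discounted_reward r g X ?\<tau>) = (\<integral>\<^sup>+\<omega>. W V ?\<tau> \<omega> \<partial>P x)"
      unfolding expectation_nonneg_def ennreal_discounted_reward[OF g] W_def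
      using exit by (intro nn_integral_cong) (simp add: space_P g_V)
    also have "\<dots> = v1 x + v2 x"
      unfolding W_sum[OF stop]
    proof (rule arg_cong2[where f="(+)"])
      show "(\<integral>\<^sup>+\<omega>. W v1 ?\<tau> \<omega> \<partial>P x) = v1 x"
        using D.exp_sup_mean_stopped_eq[OF r q1 stop, of "- x"] inside Q1(3)
        unfolding W_v1 by (simp add: v1_def less_imp_le)
      show "(\<integral>\<^sup>+\<omega>. W v2 ?\<tau> \<omega> \<partial>P x) = v2 x"
        unfolding W_def v2_def using inside Q2(3)
        by (intro exp_sup_mean_stopped_eq[OF r q2 stop]) (simp add: less_imp_le)
    qed
    finally show ?thesis by (simp add: V_sum)
  qed
qed

end

section \<open>Reduction to regular paths\<close>

context levy_process
begin

definition regularized :: "real \<Rightarrow> 'a \<Rightarrow> real" where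
  "regularized t \<omega> = (if cadlag (\<lambda>t. X t \<omega>) then X t \<omega> else 0)"

lemma AE_regularized: "AE \<omega> in P x. \<forall>t. regularized t \<omega> = X t \<omega>"
  using cadlag_paths[of x] by eventually_elim (simp add: regularized_def)

text \<open>The property \<open>cadlag\<close> involves uncountably many times. That it defines an
  event of \<open>F t\<close> comes from completeness: its failure is negligible under every
  \<open>P x\<close>.\<close>

lemma measurable_regularized:
  assumes "0 \<le> t"
  shows "regularized t \<in> borel_measurable (F (ennreal t))"
proof -
  have "{\<omega>\<in>\<Omega>. \<not> cadlag (\<lambda>t. X t \<omega>)} \<in> sets (F (ennreal t))"
  proof (rule negligible_sets_F)
    show "AE \<omega> in P x. \<omega> \<notin> {\<omega>\<in>\<Omega>. \<not> cadlag (\<lambda>t. X t \<omega>)}" for x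
      using cadlag_paths[of x] by eventually_elim simp
  qed auto
  then have "\<Omega> - {\<omega>\<in>\<Omega>. \<not> cadlag (\<lambda>t. X t \<omega>)} \<in> sets (F (ennreal t))"
    using sets.compl_sets[of _ "F (ennreal t)"] by (simp add: space_F)
  moreover have "\<Omega> - {\<omega>\<in>\<Omega>. \<not> cadlag (\<lambda>t. X t \<omega>)} = {\<omega>\<in>space (F (ennreal t)). cadlag (\<lambda>t. X t \<omega>)}"
    by (auto simp: space_F)
  ultimately have [measurable]: "Measurable.pred (F (ennreal t)) (\<lambda>\<omega>. cadlag (\<lambda>t. X t \<omega>))"
    by (simp add: pred_def)
  note [measurable] = adapted[OF assms]
  show ?thesis unfolding regularized_def by measurable
qed

lemma regularized: "regular_levy_process \<Omega> F P regularized"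
proof unfold_locales
  have meas: "regularized t \<in> borel_measurable (P x)" if "0 \<le> t" for t x
    by (rule measurable_F_P[OF measurable_regularized[OF that]])
  show "regularized t \<in> borel_measurable (F (ennreal t))" if "0 \<le> t" for t
    by (rule measurable_regularized[OF that])
  show "AE \<omega> in P x. regularized 0 \<omega> = x" for x
    using AE_regularized[of x] starts_at[of x] by eventually_elim simp
  have "cadlag (\<lambda>_. 0)" by (auto simp: cadlag_def)
  then show paths: "cadlag (\<lambda>t. regularized t \<omega>)" for \<omega>
    by (cases "cadlag (\<lambda>t. X t \<omega>)") (simp_all add: regularized_def)
  show "AE \<omega> in P x. cadlag (\<lambda>t. regularized t \<omega>)" for x
    using paths by simp
  show "prob_space.indep_set (P x) (sets (F (ennreal s)))
      (sets (vimage_algebra \<Omega> (\<lambda>\<omega>. regularized t \<omega> - regularized s \<omega>) borel))"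
    if "0 \<le> s" "s < t" for x s t
  proof -
    interpret x: prob_space "P x" by (rule prob_space_P)
    have "x.indep_set (sets (vimage_algebra (space (P x)) (\<lambda>\<omega>. X t \<omega> - X s \<omega>) borel)) (sets (F (ennreal s)))"
      using x.indep_set_commute[OF independent_increments[OF that, of x]] by (simp add: space_P)
    then have "x.indep_set (sets (vimage_algebra (space (P x)) (\<lambda>\<omega>. regularized t \<omega> - regularized s \<omega>) borel))
        (sets (F (ennreal s)))"
    proof (rule x.indep_set_vimage_AE_cong)
      show "AE \<omega> in P x. X t \<omega> - X s \<omega> = regularized t \<omega> - regularized s \<omega>"
        using AE_regularized[of x] by eventually_elim simp
    qed (use that in \<open>auto intro!: borel_measurable_diff meas measurable_X\<close>)
    from x.indep_set_commute[OF this] show ?thesis by (simp add: space_P)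
  qed
  show "distr (P x) borel (\<lambda>\<omega>. regularized (s + h) \<omega> - regularized s \<omega>)
      = distr (P 0) borel (\<lambda>\<omega>. regularized h \<omega> - regularized 0 \<omega>)" if "0 \<le> s" "0 \<le> h" for x s h
  proof -
    have eq: "distr (P y) borel (\<lambda>\<omega>. regularized b \<omega> - regularized a \<omega>)
        = distr (P y) borel (\<lambda>\<omega>. X b \<omega> - X a \<omega>)" if "0 \<le> a" "0 \<le> b" for y a b
    proof (rule distr_cong_AE)
      show "AE \<omega> in P y. regularized b \<omega> - regularized a \<omega> = X b \<omega> - X a \<omega>"
        using AE_regularized[of y] by eventually_elim simp
    qed (use that in \<open>auto intro!: borel_measurable_diff meas measurable_X\<close>)
    show ?thesis
      using that stationary_increments[OF that, of x] by (simp add: eq)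
  qed
qed

lemma regularized_independent_exponential_time:
  assumes e: "independent_exponential_time P X r e"
  shows "independent_exponential_time P regularized r e"
  unfolding independent_exponential_time_def
proof (intro allI conjI)
  fix x
  interpret prob_space "P x" by (rule prob_space_P)
  show "distributed (P x) lborel e (exponential_density r)"
    using e by (simp add: independent_exponential_time_def)
  have ind: "indep_set (sets (vimage_algebra (space (P x)) (\<lambda>\<omega>. \<lambda>t\<in>{0..}. X t \<omega>) (Pi\<^sub>M {0..} (\<lambda>_. borel))))
      (sets (vimage_algebra (space (P x)) e borel))"
    using e by (simp add: independent_exponential_time_def)
  show "indep_set (sets (vimage_algebra (space (P x)) (\<lambda>\<omega>. \<lambda>t\<in>{0..}. regularized t \<omega>) (Pi\<^sub>M {0..} (\<lambda>_. borel))))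
      (sets (vimage_algebra (space (P x)) e borel))"
  proof (rule indep_set_vimage_AE_cong[OF ind])
    show "AE \<omega> in P x. (\<lambda>t\<in>{0..}. X t \<omega>) = (\<lambda>t\<in>{0..}. regularized t \<omega>)"
      using AE_regularized[of x] by eventually_elim simp
  qed (auto intro!: measurable_restrict measurable_X measurable_F_P[OF measurable_regularized])
qed

end

theorem theorem1:
  fixes \<Omega> :: "'a set" and F :: "ennreal \<Rightarrow> 'a measure" and P :: "real \<Rightarrow> 'a measure"
    and X :: "real \<Rightarrow> 'a \<Rightarrow> real" and e :: "'a \<Rightarrow> real"
    and r x1 x2 :: real and g Q1 Q2 :: "real \<Rightarrow> real" and V :: "real \<Rightarrow> ennreal"
  assumes X: "levy_process \<Omega> F P X"
    and r: "0 < r"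
    and e: "independent_exponential_time P X r e"
    and g: "continuous_on UNIV g" "\<forall>x. 0 \<le> g x"
    and x1_x2: "- x1 < 0" "0 < x2"
    and Q1: "continuous_on UNIV Q1" "antimono Q1" "\<forall>x\<ge>- x1. Q1 x = 0"
    and Q2: "continuous_on UNIV Q2" "mono Q2" "\<forall>x\<le>x2. Q2 x = 0"
    and g_eq: "\<forall>x. x \<notin> {- x1<..<x2} \<longrightarrow>
      ennreal (g x) = expectation_nonneg (P x) (\<lambda>\<omega>. Q1 (running_inf X e \<omega>))
                    + expectation_nonneg (P x) (\<lambda>\<omega>. Q2 (running_sup X e \<omega>))"
    and V: "\<forall>x. V x =
      expectation_nonneg (P x) (\<lambda>\<omega>. Q1 (running_inf X e \<omega>) + Q2 (running_sup X e \<omega>))"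
    and V_ge: "\<forall>x\<in>{- x1..x2}. ennreal (g x) \<le> V x"
  shows "stopping_time F (exit_time X {- x1<..<x2}) \<and>
    (\<forall>x. V x = (SUP \<tau>\<in>{\<tau>. stopping_time F \<tau>}. expectation_nonneg (P x) (discounted_reward r g X \<tau>)) \<and>
         V x = expectation_nonneg (P x) (discounted_reward r g X (exit_time X {- x1<..<x2})))"
proof -
  interpret levy_process \<Omega> F P X by (rule X)
  interpret R: regular_levy_process \<Omega> F P regularized by (rule regularized)
  let ?\<tau> = "exit_time X {- x1<..<x2}" and ?\<tau>' = "exit_time regularized {- x1<..<x2}"
  \<comment> \<open>Outside a null set the two processes agree at all times simultaneously, so any
    functional of the whole path has the same integral; this covers the running extrema and the
    rewards.\<close>
  have transfer: "(\<integral>\<^sup>+\<omega>. f (\<lambda>t. regularized t \<omega>) \<omega> \<partial>P x) = (\<integral>\<^sup>+\<omega>. f (\<lambda>t. X t \<omega>) \<omega> \<partial>P x)" for f x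
  proof (rule nn_integral_cong_AE)
    show "AE \<omega> in P x. f (\<lambda>t. regularized t \<omega>) \<omega> = f (\<lambda>t. X t \<omega>) \<omega>"
      using AE_regularized[of x] by eventually_elim simp
  qed
  have inf: "expectation_nonneg (P x) (\<lambda>\<omega>. Q1 (running_inf regularized e \<omega>))
      = expectation_nonneg (P x) (\<lambda>\<omega>. Q1 (running_inf X e \<omega>))" for x
    unfolding expectation_nonneg_def running_inf_def
    by (rule transfer[where f="\<lambda>p \<omega>. ennreal (Q1 (INF t\<in>{0..e \<omega>}. p t))"])
  have sup: "expectation_nonneg (P x) (\<lambda>\<omega>. Q2 (running_sup regularized e \<omega>))
      = expectation_nonneg (P x) (\<lambda>\<omega>. Q2 (running_sup X e \<omega>))" for x
    unfolding expectation_nonneg_def running_sup_def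
    by (rule transfer[where f="\<lambda>p \<omega>. ennreal (Q2 (SUP t\<in>{0..e \<omega>}. p t))"])
  have sum: "expectation_nonneg (P x) (\<lambda>\<omega>. Q1 (running_inf regularized e \<omega>) + Q2 (running_sup regularized e \<omega>))
      = expectation_nonneg (P x) (\<lambda>\<omega>. Q1 (running_inf X e \<omega>) + Q2 (running_sup X e \<omega>))" for x
    unfolding expectation_nonneg_def running_inf_def running_sup_def
    by (rule transfer[where f="\<lambda>p \<omega>. ennreal (Q1 (INF t\<in>{0..e \<omega>}. p t) + Q2 (SUP t\<in>{0..e \<omega>}. p t))"])
  have reward: "expectation_nonneg (P x) (discounted_reward r g regularized \<tau>)
      = expectation_nonneg (P x) (discounted_reward r g X \<tau>)" for x \<tau>
    unfolding expectation_nonneg_def discounted_reward_def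
    by (rule transfer[where f="\<lambda>p \<omega>. ennreal (if \<tau> \<omega> < \<top>
        then exp (- r * enn2real (\<tau> \<omega>)) * g (p (enn2real (\<tau> \<omega>))) else 0)"])
  \<comment> \<open>The exit times of the two processes agree only almost surely. Being a stopping
    time is transferred by completeness, and the reward by equality of integrals.\<close>
  have exit: "AE \<omega> in P x. ?\<tau>' \<omega> = ?\<tau> \<omega>" for x
    using AE_regularized[of x] by eventually_elim (simp add: exit_time_def)
  note optimal = R.optimal_stopping[OF r regularized_independent_exponential_time[OF e] g(2) Q1 Q2,
      unfolded inf sup sum reward, OF g_eq V V_ge]
  have stop: "stopping_time F ?\<tau>"
    by (rule stopping_time_AE_cong[OF optimal(1) exit])
  have eq: "V x = expectation_nonneg (P x) (discounted_reward r g X ?\<tau>)" for x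
  proof -
    have "expectation_nonneg (P x) (discounted_reward r g X ?\<tau>')
        = expectation_nonneg (P x) (discounted_reward r g X ?\<tau>)"
      unfolding expectation_nonneg_def
    proof (rule nn_integral_cong_AE)
      show "AE \<omega> in P x. ennreal (discounted_reward r g X ?\<tau>' \<omega>) = ennreal (discounted_reward r g X ?\<tau> \<omega>)"
        using exit[of x] by eventually_elim (simp add: discounted_reward_def)
    qed
    with optimal(3)[of x] show ?thesis by simp
  qed
  have "V x = (SUP \<tau>\<in>{\<tau>. stopping_time F \<tau>}. expectation_nonneg (P x) (discounted_reward r g X \<tau>))" for x
  proof (rule antisym)
    show "V x \<le> (SUP \<tau>\<in>{\<tau>. stopping_time F \<tau>}. expectation_nonneg (P x) (discounted_reward r g X \<tau>))"
      \<comment> \<open>The exit time itself is admissible, so the supremum is attained.\<close>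
      unfolding eq[of x] using stop by (intro SUP_upper) simp
    show "(SUP \<tau>\<in>{\<tau>. stopping_time F \<tau>}. expectation_nonneg (P x) (discounted_reward r g X \<tau>)) \<le> V x"
      using optimal(2) by (intro SUP_least) simp
  qed
  with stop eq show ?thesis by blast
qed

end
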